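(* Let $T$ be a tree of order $n$, and let $w^-:V(T)\to \mathbb{Z}_{\geq 0}$ and $w^+:V(T)\to \mathbb{Z}_{\geq 0}$ be functions such that $w^-(S)\leq W$ for some connected $(w^-,w^+)$-safe set $S$ in $T$ and some $W\in\mathbb{N}$. Then, given $T$, $w^-$, $w^+$ (and $W$), a connected $(w^-,w^+)$-safe set in $T$ of minimum $w^-$-weight can be determined in $O(nW^4)$ time.
   Context: For a function $f:V(T)\to\mathbb{Z}_{\geq 0}$, a set $U\subseteq V(T)$ and a subgraph $H$ of $T$, let $f(U)=\sum_{u\in U}f(u)$ and $f(H)=f(V(H))$. Two disjoint subgraphs $C,D$ are adjacent if some vertex of $C$ is adjacent to some vertex of $D$. A set $S\subseteq V(T)$ is $(w^-,w^+)$-safe if $w^-(C)\geq w^+(D)$ for every component $C$ of the induced subgraph $T[S]$ and every component $D$ of $T-S$ (induced by $V(T)\setminus S$) such that $D$ is adjacent to $C$. A set $S$ is connected if $T[S]$ is connected. *)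

theory Defs
  imports "Graph_Theory.Digraph_Component"
begin

section \<open>Trees and safe sets\<close>

text \<open>
  A finite simple undirected graph is a loop-free symmetric digraph (\<^locale>\<open>pair_graph\<close>).
  The constant \<^const>\<open>tree\<close> of the library is of no use for these: every edge \<open>uv\<close> gives the
  directed cycle \<open>u, v, u\<close>. The cycles of the undirected graph are the directed ones of
  length at least three. The null graph is not \<^const>\<open>connected\<close>;
  in particular connected safe sets are nonempty.
\<close>

definition undirected_tree :: "'a pair_pre_digraph \<Rightarrow> bool" where
  "undirected_tree T \<longleftrightarrow> pair_graph T \<and> connected (with_proj T)
     \<and> \<not> (\<exists>p. pre_digraph.cycle (with_proj T) p \<and> 3 \<le> length p)"

definition is_component :: "('a, 'b) pre_digraph \<Rightarrow> ('a, 'b) pre_digraph \<Rightarrow> bool" where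
  "is_component G C \<longleftrightarrow> pre_digraph.max_subgraph G connected C"

definition safe_set ::
  "'a pair_pre_digraph \<Rightarrow> ('a \<Rightarrow> nat) \<Rightarrow> ('a \<Rightarrow> nat) \<Rightarrow> 'a set \<Rightarrow> bool" where
  "safe_set T wm wp S \<longleftrightarrow> S \<subseteq> pverts T \<and>
     (\<forall>C D. is_component (with_proj T \<restriction> S) C \<longrightarrow>
            is_component (with_proj T \<restriction> (pverts T - S)) D \<longrightarrow>
            (\<exists>u \<in> verts C. \<exists>v \<in> verts D. (u, v) \<in> parcs T) \<longrightarrow>
            (\<Sum>v \<in> verts D. wp v) \<le> (\<Sum>u \<in> verts C. wm u))"

definition connected_safe_set ::
  "'a pair_pre_digraph \<Rightarrow> ('a \<Rightarrow> nat) \<Rightarrow> ('a \<Rightarrow> nat) \<Rightarrow> 'a set \<Rightarrow> bool" where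
  "connected_safe_set T wm wp S \<longleftrightarrow> safe_set T wm wp S \<and> connected (with_proj T \<restriction> S)"

definition min_connected_safe_set ::
  "'a pair_pre_digraph \<Rightarrow> ('a \<Rightarrow> nat) \<Rightarrow> ('a \<Rightarrow> nat) \<Rightarrow> 'a set \<Rightarrow> bool" where
  "min_connected_safe_set T wm wp S \<longleftrightarrow> connected_safe_set T wm wp S \<and>
     (\<forall>S'. connected_safe_set T wm wp S' \<longrightarrow> (\<Sum>v \<in> S. wm v) \<le> (\<Sum>v \<in> S'. wm v))"

section \<open>Random access programs and their running time\<close>

text \<open>
  The machine model is the unit-cost random access machine with addition, truncated subtraction
  and comparison of natural numbers, presented as a structured programming language. A program
  uses finitely many named arrays with unbounded random access. A scalar variable is an
  array of which only cell 0 is used. There is deliberately no multiplication, because unit-cost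
  multiplication makes the model unreasonably powerful.
\<close>

type_synonym state = "string \<Rightarrow> nat \<Rightarrow> nat"

datatype aexp = Const nat | Read string aexp | Plus aexp aexp | Minus aexp aexp

datatype bexp = Less aexp aexp | Eq aexp aexp | Neg bexp | Conj bexp bexp

datatype com =
    Skip
  | Write string aexp aexp
  | Seq com com
  | Cond bexp com com
  | While bexp com

primrec aval :: "aexp \<Rightarrow> state \<Rightarrow> nat" where
  "aval (Const k) s = k"
| "aval (Read a i) s = s a (aval i s)"
| "aval (Plus e f) s = aval e s + aval f s"
| "aval (Minus e f) s = aval e s - aval f s"

primrec bval :: "bexp \<Rightarrow> state \<Rightarrow> bool" where
  "bval (Less e f) s \<longleftrightarrow> aval e s < aval f s"
| "bval (Eq e f) s \<longleftrightarrow> aval e s = aval f s"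
| "bval (Neg b) s \<longleftrightarrow> \<not> bval b s"
| "bval (Conj b c) s \<longleftrightarrow> bval b s \<and> bval c s"

primrec acost :: "aexp \<Rightarrow> nat" where
  "acost (Const k) = 1"
| "acost (Read a i) = 1 + acost i"
| "acost (Plus e f) = 1 + acost e + acost f"
| "acost (Minus e f) = 1 + acost e + acost f"

primrec bcost :: "bexp \<Rightarrow> nat" where
  "bcost (Less e f) = 1 + acost e + acost f"
| "bcost (Eq e f) = 1 + acost e + acost f"
| "bcost (Neg b) = 1 + bcost b"
| "bcost (Conj b c) = 1 + bcost b + bcost c"

text \<open>\<open>exec c s t s'\<close>: started in \<open>s\<close>, the program \<open>c\<close> halts after exactly \<open>t\<close> time units in \<open>s'\<close>.\<close>

inductive exec :: "com \<Rightarrow> state \<Rightarrow> nat \<Rightarrow> state \<Rightarrow> bool" where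
  Skip: "exec Skip s 1 s"
| Write: "exec (Write a i e) s (1 + acost i + acost e) (s(a := (s a)(aval i s := aval e s)))"
| Seq: "exec c s t s' \<Longrightarrow> exec d s' u s'' \<Longrightarrow> exec (Seq c d) s (t + u) s''"
| CondTrue: "bval b s \<Longrightarrow> exec c s t s' \<Longrightarrow> exec (Cond b c d) s (1 + bcost b + t) s'"
| CondFalse: "\<not> bval b s \<Longrightarrow> exec d s t s' \<Longrightarrow> exec (Cond b c d) s (1 + bcost b + t) s'"
| WhileFalse: "\<not> bval b s \<Longrightarrow> exec (While b c) s (1 + bcost b) s"
| WhileTrue: "bval b s \<Longrightarrow> exec c s t s' \<Longrightarrow> exec (While b c) s' u s'' \<Longrightarrow>
    exec (While b c) s (1 + bcost b + t + u) s''"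

inductive_cases SkipE: "exec Skip s t s'"
inductive_cases WriteE: "exec (Write a i e) s t s'"
inductive_cases SeqE: "exec (Seq c d) s t s'"
inductive_cases CondE: "exec (Cond b c d) s t s'"
inductive_cases WhileE: "exec (While b c) s t s'"

lemma exec_deterministic:
  "exec c s t s' \<Longrightarrow> exec c s u s'' \<Longrightarrow> u = t \<and> s'' = s'"
proof (induction arbitrary: u s'' rule: exec.induct)
  case (Seq c s t s' d v r)
  from Seq.prems show ?case by (rule SeqE) (metis Seq.IH)
next
  case (WhileFalse b s c)
  from WhileFalse.prems show ?case by (rule WhileE) (simp_all add: WhileFalse.hyps)
next
  case (WhileTrue b s c t s' v r)
  obtain t' q v'
    where u: "u = Suc (bcost b + t' + v')"
      and c: "exec c s t' q" and w: "exec (While b c) q v' s''"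
    by (rule WhileE[OF WhileTrue.prems]) (use WhileTrue.hyps(1) in blast)+
  from WhileTrue.IH(1)[OF c] have q: "t' = t" "q = s'" by simp_all
  from WhileTrue.IH(2)[OF w[unfolded q]] show ?case by (simp add: u q)
next
  case (CondTrue b s c t s' d)
  from CondTrue.prems show ?case
    by (rule CondE) (simp_all add: CondTrue.hyps CondTrue.IH)
next
  case (CondFalse b s d t s' c)
  from CondFalse.prems show ?case
    by (rule CondE) (simp_all add: CondFalse.hyps CondFalse.IH)
qed (auto elim: SkipE WriteE)

section \<open>Encoding of instances and solutions\<close>

text \<open>Every undirected edge is listed exactly once, in either orientation and in any order.\<close>

definition is_edge_list :: "'a pair_pre_digraph \<Rightarrow> ('a \<times> 'a) list \<Rightarrow> bool" where
  "is_edge_list T es \<longleftrightarrow>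
     parcs T = set es \<union> (set es)\<inverse> \<and> distinct (map (\<lambda>(u, v). {u, v}) es)"

definition input_state ::
  "nat \<Rightarrow> (nat \<times> nat) list \<Rightarrow> (nat \<Rightarrow> nat) \<Rightarrow> (nat \<Rightarrow> nat) \<Rightarrow> nat \<Rightarrow> state" where
  "input_state n es wm wp W = (\<lambda>a i. 0)
     (''n'' := (\<lambda>i. if i = 0 then n else 0),
      ''W'' := (\<lambda>i. if i = 0 then W else 0),
      ''wm'' := (\<lambda>i. if i < n then wm i else 0),
      ''wp'' := (\<lambda>i. if i < n then wp i else 0),
      ''src'' := (\<lambda>i. if i < length es then fst (es ! i) else 0),
      ''dst'' := (\<lambda>i. if i < length es then snd (es ! i) else 0))"

definition output_set :: "nat \<Rightarrow> state \<Rightarrow> nat set" where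
  "output_set n s = {v. v < n \<and> s ''out'' v \<noteq> 0}"

end

theory Submission
  imports Defs
begin

text \<open>
  A connected set \<open>S\<close> of \<open>w\<^sup>-\<close>-weight exactly \<open>k\<close> is safe iff no component of \<open>T - S\<close> has
  \<open>w\<^sup>+\<close>-weight above \<open>k\<close>. Root \<open>T\<close> by repeatedly peeling off leaves, which takes linear time. For
  fixed \<open>k\<close>, merging the vertices into their parents one by one in the order of peeling is a knapsack
  recursion: for every vertex \<open>u\<close> it computes the weights \<open>j \<le> k\<close> of connected sets with topmost
  vertex \<open>u\<close> all of whose hanging subtrees have weight at most \<open>k\<close>. A merge costs \<open>O((k + 1)\<^sup>2)\<close>.
  The first \<open>k\<close> for which weight \<open>k\<close> is attained at some \<open>u\<close> whose subtree misses at most \<open>k\<close> of the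
  total weight is the optimum, and recorded choices yield an optimal set. As \<open>k \<le> W\<close>, the total time
  is even \<open>O(n W\<^sup>3)\<close>.
\<close>

section \<open>Connected safe sets in terms of cuts\<close>

text \<open>The threshold in the safety condition is the weight of the very set that is sought.
  Asking for weight exactly \<open>k\<close> makes the threshold a constant, and then the decision
  to leave out a hanging subtree depends on that subtree alone.

  The peeling order places every child before its parent, so the recursion over the tree becomes a
  loop that counts upwards and the traceback one that counts downwards. Acyclicity is used at a
  single point, the existence of a leaf. Everything else rests on connectivity, stated by cuts
  instead of paths: a cut is easily extended over a deleted leaf or moved along a relabelling,
  whereas paths would have to be rerouted. Nonemptiness is demanded as in \<open>connected\<close>.

  The machine cannot multiply, so row addresses of the two-dimensional tables are prepared in
  advance. Vertex weights may exceed \<open>W\<close>, but they are only compared with column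
  numbers and never index a table.\<close>

definition cut_connected :: "('a \<times> 'a) set \<Rightarrow> 'a set \<Rightarrow> bool" where
  "cut_connected E X \<longleftrightarrow> X \<noteq> {} \<and>
     (\<forall>A. A \<subseteq> X \<longrightarrow> A \<noteq> {} \<longrightarrow> A \<noteq> X \<longrightarrow> (\<exists>x\<in>A. \<exists>y\<in>X - A. (x, y) \<in> E))"

text \<open>\<open>D\<close> ranges over all connected sets that avoid \<open>S\<close>. As weights
  are nonnegative, this is the same bound as for maximal ones, and no maximality has to be carried
  through relabelling and rooting.\<close>

definition cut_safe ::
  "('a \<times> 'a) set \<Rightarrow> 'a set \<Rightarrow> ('a \<Rightarrow> nat) \<Rightarrow> ('a \<Rightarrow> nat) \<Rightarrow> 'a set \<Rightarrow> bool" where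
  "cut_safe E V a b S \<longleftrightarrow> S \<subseteq> V \<and> cut_connected E S \<and>
     (\<forall>D. D \<subseteq> V - S \<longrightarrow> cut_connected E D \<longrightarrow> sum b D \<le> sum a S)"

section \<open>Rooted trees with increasing parents\<close>

text \<open>The vertices are \<open>0, \<dots>, n - 1\<close>, the root is \<open>n - 1\<close>, and every other vertex \<open>i\<close> has a
  parent \<open>p i > i\<close>; the value of \<open>p\<close> at the root is irrelevant.\<close>

locale increasing_tree =
  fixes n :: nat and p :: "nat \<Rightarrow> nat"
  assumes pos: "0 < n"
    and parent_greater: "Suc i < n \<Longrightarrow> i < p i"
    and parent_less: "Suc i < n \<Longrightarrow> p i < n"
begin

definition edges :: "(nat \<times> nat) set" where
  "edges = {(i, p i) |i. Suc i < n} \<union> {(p i, i) |i. Suc i < n}"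

text \<open>The vertices below \<open>v\<close> when only the edges from \<open>0, \<dots>, h - 1\<close> to their parents are present.\<close>

inductive_set below :: "nat \<Rightarrow> nat \<Rightarrow> nat set" for h v where
  refl: "v \<in> below h v"
| step: "x < h \<Longrightarrow> p x \<in> below h v \<Longrightarrow> x \<in> below h v"

abbreviation "subtree \<equiv> below (n - 1)"

lemma below_cases: "x \<in> below h v \<Longrightarrow> x = v \<or> x < h \<and> p x \<in> below h v"
  by (auto elim: below.cases)

lemma below_0: "below 0 v = {v}"
  by (auto elim: below.cases intro: below.refl)

lemma below_le: "x \<in> below h v \<Longrightarrow> h < n \<Longrightarrow> x \<le> v"
proof (induction rule: below.induct)
  case (step x)
  then show ?case using parent_greater[of x] by simp
qed simp

lemma below_subset: "h < n \<Longrightarrow> v < n \<Longrightarrow> below h v \<subseteq> {..<n}"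
  using below_le by fastforce

lemma finite_below [simp]: "h < n \<Longrightarrow> finite (below h v)"
  using below_le by (intro finite_subset[OF _ finite_atMost[of v]]) auto

lemma below_mono: "x \<in> below h v \<Longrightarrow> h \<le> h' \<Longrightarrow> x \<in> below h' v"
  by (induction rule: below.induct) (auto intro: below.intros)

lemma below_trans: "x \<in> below h y \<Longrightarrow> y \<in> below h z \<Longrightarrow> x \<in> below h z"
  by (induction rule: below.induct) (auto intro: below.intros)

text \<open>When the edge from \<open>h\<close> is added, its upper end \<open>p h\<close> exceeds
  \<open>h\<close> and is therefore still the top of its own block. Hence only the block of
  \<open>p h\<close> grows, absorbing that of \<open>h\<close>: each merge of the recursion changes
  a single entry.\<close>

lemma below_Suc:
  assumes h: "Suc h < n"
  shows "below (Suc h) v = (if p h = v then below h v \<union> below h h else below h v)"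
proof -
  have *: "x \<in> (if p h = v then below h v \<union> below h h else below h v)" if "x \<in> below (Suc h) v" for x
    using that
  proof (induction rule: below.induct)
    case refl
    then show ?case by (auto intro: below.refl)
  next
    case (step x)
    show ?case
    proof (cases "x = h")
      case True
      have "p h \<noteq> v \<Longrightarrow> p h \<notin> below h v"
        using below_cases[of "p h" h v] parent_greater[OF h] by auto
      then show ?thesis using step True by (auto intro: below.refl)
    next
      case False
      then show ?thesis using step by (auto intro: below.step split: if_splits)
    qed
  qed
  have "below h v \<subseteq> below (Suc h) v" using below_mono by force
  moreover have "below h h \<subseteq> below (Suc h) v" if "p h = v"
    using that below_mono[of _ h h "Suc h"] below_trans[of _ "Suc h" h v]
      below.step[of h "Suc h" v] below.refl[of v "Suc h"] by auto
  ultimately show ?thesis using * by (cases "p h = v") (simp, blast, simp, blast)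
qed

text \<open>Membership in \<open>below h h\<close> would pass from a vertex to its parent all the
  way up to \<open>v = p h\<close>, but \<open>v\<close> exceeds \<open>h\<close>.\<close>

lemma below_disjoint:
  assumes h: "Suc h < n" and v: "p h = v"
  shows "below h v \<inter> below h h = {}"
proof -
  have "x \<notin> below h h" if "x \<in> below h v" for x
    using that
  proof (induction rule: below.induct)
    case refl
    then show ?case using below_le[of v h h] parent_greater[OF h] v h by auto
  next
    case (step x)
    then show ?case using below_cases[of x h h] by auto
  qed
  then show ?thesis by auto
qed

lemma subtree_parent_iff:
  assumes "Suc x < n" "x \<noteq> v"
  shows "p x \<in> subtree v \<longleftrightarrow> x \<in> subtree v"
  using assms below_cases[of x "n - 1" v] by (auto intro: below.step)

lemma subtree_root: "subtree (n - 1) = {..<n}"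
proof -
  have "x \<in> subtree (n - 1)" if "x < n" for x
    using that
  proof (induction "n - x" arbitrary: x rule: less_induct)
    case less
    show ?case
    proof (cases "Suc x < n")
      case True
      then have "p x \<in> subtree (n - 1)"
        using parent_greater[of x] parent_less[of x] by (intro less(1)) auto
      then show ?thesis using True by (auto intro: below.step[of x])
    next
      case False
      then have "x = n - 1" using less(2) by auto
      then show ?thesis by (simp add: below.refl)
    qed
  qed
  then show ?thesis using below_subset[of "n - 1" "n - 1"] pos by auto
qed

section \<open>Connectivity and safety in the rooted tree\<close>

lemma edges_subtree:
  assumes "(x, y) \<in> edges" "x \<in> subtree v" "y \<notin> subtree v"
  shows "x = v \<and> y = p v \<and> Suc v < n"
proof -
  consider "y = p x" "Suc x < n" | "x = p y" "Suc y < n"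
    using assms(1) by (auto simp: edges_def)
  then show ?thesis
  proof cases
    case 1
    then show ?thesis using assms subtree_parent_iff[of x v] by auto
  next
    case 2
    then show ?thesis using assms subtree_parent_iff[of y v] below.refl by auto
  qed
qed

text \<open>Parents have larger numbers, so the ascent from \<open>x\<close> inside \<open>X\<close>
  terminates, and \<open>m\<close> is the only vertex at which it may stop. The induction on
  \<open>n - x\<close> is this ascent.\<close>

lemma subset_subtree_if_parent_closed:
  assumes "X \<subseteq> {..<n}" "\<And>x. x \<in> X \<Longrightarrow> x \<noteq> m \<Longrightarrow> Suc x < n \<and> p x \<in> X"
  shows "X \<subseteq> subtree m"
proof
  fix x assume "x \<in> X"
  then show "x \<in> subtree m"
  proof (induction "n - x" arbitrary: x rule: less_induct)
    case less
    show ?case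
    proof (cases "x = m")
      case False
      then have *: "Suc x < n" "p x \<in> X" using assms(2) less(2) by auto
      then have "p x \<in> subtree m" using parent_greater[of x] by (intro less(1)) auto
      then show ?thesis using * by (auto intro: below.step[of x])
    qed (simp add: below.refl)
  qed
qed

lemma Max_parent_less:
  assumes "X \<subseteq> {..<n}" "x \<in> X" "x \<noteq> Max X"
  shows "Suc x < n"
proof -
  have fin: "finite X" using assms finite_subset by auto
  have "x < Max X" using assms Max_ge[OF fin] order.not_eq_order_implies_strict by blast
  moreover have "Max X < n" using assms Max_in[OF fin] by auto
  ultimately show ?thesis by simp
qed

text \<open>If \<open>x\<close> is not the largest element, the part of \<open>X\<close> in
  \<open>subtree x\<close> misses \<open>Max X\<close>, and the only edge out of that subtree leads
  from \<open>x\<close> to \<open>p x\<close>. Conversely, every ascent inside \<open>X\<close> ends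
  at \<open>Max X\<close>, so a part of \<open>X\<close> without an outgoing edge contains
  everything or nothing.\<close>

lemma cut_connected_iff:
  assumes X: "X \<subseteq> {..<n}"
  shows "cut_connected edges X \<longleftrightarrow> X \<noteq> {} \<and> (\<forall>x\<in>X. x \<noteq> Max X \<longrightarrow> p x \<in> X)" (is "?L \<longleftrightarrow> ?R")
proof
  have fin: "finite X" using X finite_subset by auto
  {
    assume L: ?L
    then have ne: "X \<noteq> {}" by (auto simp: cut_connected_def)
    have "p x \<in> X" if x: "x \<in> X" "x \<noteq> Max X" for x
    proof -
      have sx: "Suc x < n" using Max_parent_less[OF X x] .
      have "Max X \<notin> subtree x" using below_le[of "Max X" "n - 1" x] x Max_ge[OF fin, of x] pos by auto
      moreover have "Max X \<in> X" using fin ne by simp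
      ultimately have "X \<inter> subtree x \<noteq> X" by blast
      moreover have "X \<inter> subtree x \<noteq> {}" using x below.refl by blast
      ultimately have "\<exists>y\<in>X \<inter> subtree x. \<exists>z\<in>X - X \<inter> subtree x. (y, z) \<in> edges"
        using L[unfolded cut_connected_def, THEN conjunct2, rule_format, of "X \<inter> subtree x"] by blast
      then obtain y z where "y \<in> X" "y \<in> subtree x" "z \<in> X" "z \<notin> subtree x" "(y, z) \<in> edges"
        by blast
      then show ?thesis using edges_subtree by blast
    qed
    then show ?R using ne by auto
  }
  {
    assume R: ?R
    show ?L unfolding cut_connected_def
    proof (intro conjI allI impI)
      show "X \<noteq> {}" using R by simp
      fix A assume A: "A \<subseteq> X" "A \<noteq> {}" "A \<noteq> X"
      show "\<exists>x\<in>A. \<exists>y\<in>X - A. (x, y) \<in> edges"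
      proof (rule ccontr)
        assume no: "\<not> ?thesis"
        have "x \<in> A \<longleftrightarrow> Max X \<in> A" if "x \<in> X" for x
          using that
        proof (induction "n - x" arbitrary: x rule: less_induct)
          case less
          show ?case
          proof (cases "x = Max X")
            case False
            have sx: "Suc x < n" using Max_parent_less[OF X less(2) False] .
            have px: "p x \<in> X" using R less(2) False by auto
            have "p x \<in> A \<longleftrightarrow> Max X \<in> A"
              using less(1)[OF _ px] parent_greater[OF sx] sx by simp
            moreover have "x \<in> A \<longleftrightarrow> p x \<in> A"
              using no px less(2) sx by (auto simp: edges_def)
            ultimately show ?thesis by simp
          qed simp
        qed
        then show False using A by blast
      qed
    qed
  }
qed

text \<open>The components of the complement of a connected set with topmost vertex \<open>u\<close> are the subtrees
  hanging below it and, if nonempty, everything outside the subtree of \<open>u\<close>.\<close>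

definition top_safe :: "(nat \<Rightarrow> nat) \<Rightarrow> nat \<Rightarrow> nat \<Rightarrow> nat set \<Rightarrow> bool" where
  "top_safe b k u S \<longleftrightarrow> u \<in> S \<and> S \<subseteq> {..u} \<and> u < n \<and> (\<forall>x\<in>S. x \<noteq> u \<longrightarrow> p x \<in> S) \<and>
     (\<forall>i. Suc i < n \<longrightarrow> i \<notin> S \<longrightarrow> p i \<in> S \<longrightarrow> sum b (subtree i) \<le> k) \<and>
     sum b {..<n} \<le> k + sum b (subtree u)"

lemma top_safe_Max: "top_safe b k u S \<Longrightarrow> Max S = u"
  by (rule Max_eqI) (auto simp: top_safe_def intro: finite_subset)

text \<open>The ascent from \<open>m\<close> to \<open>u\<close> begins outside \<open>S\<close> and
  ends inside; \<open>i\<close> is the vertex from which it first steps into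
  \<open>S\<close>.\<close>

lemma entrance:
  assumes "m \<in> subtree u" "u \<in> S" "m \<notin> S"
  shows "\<exists>i. Suc i < n \<and> i \<notin> S \<and> p i \<in> S \<and> m \<in> subtree i"
  using assms
proof (induction rule: below.induct)
  case (step x)
  show ?case
  proof (cases "p x \<in> S")
    case True
    then show ?thesis using step below.refl by (intro exI[of _ x]) auto
  next
    case False
    then obtain i where "Suc i < n" "i \<notin> S" "p i \<in> S" "p x \<in> subtree i" using step by auto
    then show ?thesis using step(1) by (intro exI[of _ i]) (auto intro: below.step)
  qed
qed auto

text \<open>The ascent from \<open>x\<close> to \<open>v\<close> stays in \<open>S\<close>, because
  \<open>S\<close> can be left only above \<open>u\<close>. In contrapositive form: the block of a
  vertex outside \<open>S\<close> is disjoint from \<open>S\<close>.\<close>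

lemma below_top_closed:
  assumes "x \<in> below h v" "h < n" "v \<le> u" "x \<in> S" "\<forall>x\<in>S. x \<noteq> u \<longrightarrow> p x \<in> S"
  shows "v \<in> S"
  using assms
proof (induction rule: below.induct)
  case (step x)
  have "x < p x" using step parent_greater by auto
  also have "p x \<le> v" using step below_le by auto
  finally have "x \<noteq> u" using step by auto
  then show ?case using step by auto
qed auto

text \<open>Two kinds of sets decide: the hanging subtrees and the set outside
  \<open>subtree u\<close>. They are themselves connected, which gives one direction. For the other,
  every connected \<open>D\<close> avoiding \<open>S\<close> lies in one of them, according to
  whether \<open>Max D\<close> is below \<open>u\<close>.\<close>

lemma cut_safe_iff_top_safe:
  "cut_safe edges {..<n} a b S \<longleftrightarrow> (\<exists>u. top_safe b (sum a S) u S)" (is "?L \<longleftrightarrow> ?R")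
proof
  assume L: ?L
  have S: "S \<subseteq> {..<n}" using L by (simp add: cut_safe_def)
  have fin: "finite S" using S finite_subset by auto
  have R: "S \<noteq> {}" "\<forall>x\<in>S. x \<noteq> Max S \<longrightarrow> p x \<in> S"
    using L cut_connected_iff[OF S] by (auto simp: cut_safe_def)
  define u where "u = Max S"
  have u: "u \<in> S" "S \<subseteq> {..u}" "u < n" using R fin S by (auto simp: u_def)
  have hang: "sum b (subtree i) \<le> sum a S" if i: "Suc i < n" "i \<notin> S" "p i \<in> S" for i
  proof -
    have iu: "i < u" using i parent_greater[of i] u by auto
    have sub: "subtree i \<subseteq> {..<n}" using i pos by (intro below_subset) auto
    have "Max (subtree i) = i" using below_le pos
      by (intro Max_eqI) (auto intro: below.refl)
    then have "cut_connected edges (subtree i)"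
      using below.refl[of i "n - 1"] below_cases[of _ "n - 1" i]
      unfolding cut_connected_iff[OF sub] by auto
    moreover have "subtree i \<inter> S = {}"
      using below_top_closed[of _ "n - 1" i u S] iu i R u_def pos by auto
    ultimately show ?thesis using L sub unfolding cut_safe_def by blast
  qed
  \<comment> \<open>If \<open>u\<close> is the root, nothing lies outside, and the empty set is not
    \<open>cut_connected\<close>; hence the case distinction.\<close>
  have "sum b ({..<n} - subtree u) \<le> sum a S"
  proof (cases "{..<n} - subtree u = {}")
    case False
    let ?X = "{..<n} - subtree u"
    have px: "p x \<in> ?X" if "x \<in> ?X" "Suc x < n" for x
      using that subtree_parent_iff[of x u] parent_less[of x] below.refl[of u] by auto
    have "cut_connected edges ?X"
    proof (subst cut_connected_iff, simp, intro conjI ballI impI)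
      fix x assume "x \<in> ?X" "x \<noteq> Max ?X"
      then show "p x \<in> ?X" using px Max_parent_less[of ?X x] by auto
    qed (use False in auto)
    moreover have "S \<subseteq> subtree u"
      using R(2) Max_parent_less[OF S] unfolding u_def
      by (intro subset_subtree_if_parent_closed S conjI) blast+
    ultimately show ?thesis
      using L[unfolded cut_safe_def, THEN conjunct2, THEN conjunct2, rule_format, of ?X] by blast
  next
    case True
    show ?thesis unfolding True by simp
  qed
  moreover have "sum b {..<n} = sum b ({..<n} - subtree u) + sum b (subtree u)"
    using below_subset[of "n - 1" u] u pos
    by (intro sum.subset_diff) auto
  ultimately have "top_safe b (sum a S) u S" unfolding top_safe_def using u hang R u_def by auto
  then show ?R by blast
next
  assume ?R
  then obtain u where T: "top_safe b (sum a S) u S" by blast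
  note t = T[unfolded top_safe_def]
  have S: "S \<subseteq> {..<n}" using t by auto
  show ?L unfolding cut_safe_def
  proof (intro conjI allI impI)
    show "S \<subseteq> {..<n}" by fact
    show "cut_connected edges S" using t top_safe_Max[OF T] by (subst cut_connected_iff[OF S]) auto
    fix D assume D: "D \<subseteq> {..<n} - S" and "cut_connected edges D"
    then have D': "D \<subseteq> {..<n}" "D \<noteq> {}" "\<And>x. x \<in> D \<Longrightarrow> x \<noteq> Max D \<Longrightarrow> p x \<in> D"
      using cut_connected_iff[of D] by auto
    define m where "m = Max D"
    have m: "m \<in> D" using D' finite_subset[OF D'(1)] by (auto simp: m_def)
    have Dm: "D \<subseteq> subtree m"
      using D' Max_parent_less[OF D'(1)] by (intro subset_subtree_if_parent_closed) (auto simp: m_def)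
    show "sum b D \<le> sum a S"
    proof (cases "m \<in> subtree u")
      case True
      then obtain i where i: "Suc i < n" "i \<notin> S" "p i \<in> S" "m \<in> subtree i"
        using entrance[of m u S] t m D by auto
      have "D \<subseteq> subtree i" using Dm below_trans i(4) by blast
      then have "sum b D \<le> sum b (subtree i)" using pos by (intro sum_mono2) auto
      also have "\<dots> \<le> sum a S" using t i by auto
      finally show ?thesis .
    next
      case False
      \<comment> \<open>The ascent from \<open>x\<close> to \<open>m\<close> stays in
        \<open>D\<close>; if it began in \<open>subtree u\<close>, it could leave only through
        \<open>u\<close>, which belongs to \<open>S\<close>.\<close>
      have "x \<notin> subtree u" if "x \<in> D" for x
        using that
      proof (induction "n - x" arbitrary: x rule: less_induct)
        case less
        show ?case
        proof (cases "x = m")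
          case False
          have sx: "Suc x < n" using Max_parent_less[OF D'(1) less(2)] False m_def by simp
          have "p x \<in> D" using D' less(2) False m_def by auto
          then have "p x \<notin> subtree u" using less(1)[of "p x"] parent_greater[OF sx] sx by simp
          moreover have "x \<noteq> u" using t less(2) D by auto
          ultimately show ?thesis using subtree_parent_iff[OF sx] by simp
        qed (use \<open>m \<notin> subtree u\<close> in simp)
      qed
      then have "sum b D \<le> sum b ({..<n} - subtree u)" using D' by (intro sum_mono2) auto
      moreover have "sum b {..<n} = sum b ({..<n} - subtree u) + sum b (subtree u)"
        using below_subset[of "n - 1" u] t pos by (intro sum.subset_diff) auto
      ultimately show ?thesis using t by auto
    qed
  qed
qed

subsection \<open>The knapsack recursion\<close>

text \<open>\<open>attainable a b k h u j\<close>: some set of \<open>a\<close>-weight \<open>j\<close> with topmost vertex \<open>u\<close>, inside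
  \<open>below h u\<close>, is connected and leaves only hanging subtrees of \<open>b\<close>-weight at most \<open>k\<close>.\<close>

primrec attainable :: "(nat \<Rightarrow> nat) \<Rightarrow> (nat \<Rightarrow> nat) \<Rightarrow> nat \<Rightarrow> nat \<Rightarrow> nat \<Rightarrow> nat \<Rightarrow> bool" where
  "attainable a b k 0 u j \<longleftrightarrow> j = a u"
| "attainable a b k (Suc h) u j \<longleftrightarrow>
     (if p h = u then (attainable a b k h u j \<and> sum b (subtree h) \<le> k) \<or>
        (\<exists>l\<le>j. attainable a b k h u (j - l) \<and> attainable a b k h h l)
      else attainable a b k h u j)"

text \<open>The witness at every stage is the part of \<open>S\<close> in the current block. At a
  merge this part splits into two disjoint pieces if \<open>h\<close> is in \<open>S\<close>;
  otherwise the block of \<open>h\<close> misses \<open>S\<close> and \<open>h\<close> hangs below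
  it.\<close>

lemma attainable_top_safe:
  assumes T: "top_safe b k u S"
  shows "h < n \<Longrightarrow> x \<in> S \<Longrightarrow> attainable a b k h x (sum a (S \<inter> below h x))"
proof (induction h arbitrary: x)
  case 0
  then have "S \<inter> below 0 x = {x}" by (auto simp: below_0)
  then show ?case by simp
next
  case (Suc h)
  note t = T[unfolded top_safe_def]
  have h: "h < n" using Suc by simp
  show ?case
  proof (cases "p h = x")
    case True
    show ?thesis
    proof (cases "h \<in> S")
      case hS: True
      have "S \<inter> below (Suc h) x = (S \<inter> below h x) \<union> (S \<inter> below h h)"
        using below_Suc[OF Suc(2)] True by auto
      then have "sum a (S \<inter> below (Suc h) x) = sum a (S \<inter> below h x) + sum a (S \<inter> below h h)"
        using below_disjoint[OF Suc(2) True] h by (simp, subst sum.union_disjoint) auto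
      then show ?thesis using True Suc.IH[OF h Suc(3)] Suc.IH[OF h hS] by auto
    next
      case hS: False
      have "h \<le> u" using parent_greater[OF Suc(2)] True Suc(3) t by auto
      then have "S \<inter> below h h = {}"
        using below_top_closed[of _ h h u S] h hS t by blast
      then have "S \<inter> below (Suc h) x = S \<inter> below h x"
        using below_Suc[OF Suc(2)] True by auto
      then show ?thesis using True Suc.IH[OF h Suc(3)] t hS Suc by auto
    qed
  next
    case False
    then show ?thesis using Suc below_Suc[OF Suc(2)] by auto
  qed
qed

lemma top_safe_imp_attainable:
  assumes T: "top_safe b k u S"
  shows "attainable a b k (n - 1) u (sum a S)"
proof -
  note t = T[unfolded top_safe_def]
  have S: "S \<subseteq> {..<n}" using t by auto
  have "S \<subseteq> subtree u"
    using t Max_parent_less[OF S] top_safe_Max[OF T] by (intro subset_subtree_if_parent_closed S) auto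
  then have "S \<inter> subtree u = S" by blast
  then show ?thesis using attainable_top_safe[OF T, of "n - 1" u a] t pos by auto
qed

text \<open>\<open>traced a b k u h I c\<close> is the state of the traceback from \<open>u\<close> after the edges above
  \<open>n - 1, \<dots>, h\<close> have been treated: \<open>I\<close> is the set of selected vertices, and \<open>c x\<close> is the weight that
  remains to be realised by a set with topmost vertex \<open>x\<close>.\<close>

definition traced ::
  "(nat \<Rightarrow> nat) \<Rightarrow> (nat \<Rightarrow> nat) \<Rightarrow> nat \<Rightarrow> nat \<Rightarrow> nat \<Rightarrow> nat set \<Rightarrow> (nat \<Rightarrow> nat) \<Rightarrow> bool" where
  "traced a b k u h I c \<longleftrightarrow> u \<in> I \<and> I \<subseteq> {..u} \<and> (\<forall>x\<in>I. x \<noteq> u \<longrightarrow> h \<le> x \<and> p x \<in> I) \<and>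
     (\<forall>i. h \<le> i \<longrightarrow> Suc i < n \<longrightarrow> i \<notin> I \<longrightarrow> p i \<in> I \<longrightarrow> sum b (subtree i) \<le> k) \<and>
     (\<forall>x\<in>I. attainable a b k h x (c x)) \<and> sum c I = k"

lemma traced_init:
  assumes "attainable a b k (n - 1) u k" "c u = k"
  shows "traced a b k u (n - 1) {u} c"
  using assms by (auto simp: traced_def)

text \<open>This lemma and the next two undo the merge of \<open>h\<close> into \<open>p h\<close>:
  the parent is not selected, the child is left out, or the child receives weight
  \<open>l\<close>.\<close>

lemma traced_skip:
  assumes "traced a b k u (Suc h) I c" "Suc h < n" "p h \<notin> I"
  shows "traced a b k u h I c"
proof -
  have "attainable a b k h x (c x)" if "x \<in> I" for x
  proof -
    have "p h \<noteq> x" "attainable a b k (Suc h) x (c x)"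
      using assms that by (auto simp: traced_def)
    then show ?thesis by simp
  qed
  moreover have "sum b (subtree i) \<le> k" if "h \<le> i" "Suc i < n" "i \<notin> I" "p i \<in> I" for i
  proof -
    have "Suc h \<le> i" using that assms(3) by (metis Suc_leI le_neq_implies_less)
    then show ?thesis using that assms(1) unfolding traced_def by blast
  qed
  ultimately show ?thesis using assms unfolding traced_def by (auto intro: Suc_leD)
qed

lemma traced_reject:
  assumes "traced a b k u (Suc h) I c" "Suc h < n" "p h \<in> I"
    and "attainable a b k h (p h) (c (p h))" "sum b (subtree h) \<le> k"
  shows "traced a b k u h I c"
proof -
  have "attainable a b k h x (c x)" if "x \<in> I" for x
  proof (cases "p h = x")
    case False
    moreover have "attainable a b k (Suc h) x (c x)"
      using assms that by (auto simp: traced_def)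
    ultimately show ?thesis by simp
  qed (use assms in simp)
  moreover have "sum b (subtree i) \<le> k" if "h \<le> i" "Suc i < n" "i \<notin> I" "p i \<in> I" for i
  proof (cases "i = h")
    case False
    then have "Suc h \<le> i" using that by simp
    then show ?thesis using that assms(1) unfolding traced_def by blast
  qed (use assms in simp)
  ultimately show ?thesis using assms unfolding traced_def by (auto intro: Suc_leD)
qed

lemma traced_select:
  assumes T: "traced a b k u (Suc h) I c" "Suc h < n" "p h \<in> I"
    and l: "l \<le> c (p h)" "attainable a b k h (p h) (c (p h) - l)" "attainable a b k h h l"
  shows "traced a b k u h (insert h I) (c(h := l, p h := c (p h) - l))" (is "traced _ _ _ _ _ ?I ?c")
proof -
  note t = T(1)[unfolded traced_def]
  have ph: "h < p h" using parent_greater T by auto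
  \<comment> \<open>All members of \<open>I\<close> but \<open>u\<close> are at least
    \<open>Suc h\<close>, so \<open>h\<close> has not been selected before.\<close>
  have "h \<noteq> u" using ph t T by auto
  then have h: "h \<notin> I" using t by auto
  have fin: "finite I" using t finite_subset[of I "{..u}"] by auto
  have "attainable a b k h x (?c x)" if "x \<in> insert h I" for x
  proof (cases "x = h \<or> x = p h")
    case False
    then have "attainable a b k (Suc h) x (c x)" using t that by auto
    then show ?thesis using False by auto
  qed (use l ph in auto)
  moreover have "sum ?c ?I = k"
  proof -
    have "sum ?c ?I = ?c h + sum ?c I" using h fin by simp
    also have "sum ?c I = ?c (p h) + sum ?c (I - {p h})" using T fin by (simp add: sum.remove)
    also have "sum ?c (I - {p h}) = sum c (I - {p h})" using h by (intro sum.cong) auto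
    also have "?c h + (?c (p h) + sum c (I - {p h})) = c (p h) + sum c (I - {p h})" using l ph by auto
    also have "\<dots> = sum c I" using T fin by (simp add: sum.remove)
    also have "\<dots> = k" using t by blast
    finally show ?thesis .
  qed
  \<comment> \<open>The new member \<open>h\<close> is a parent of smaller vertices only, so it
    produces no new hanging subtree in the range already treated.\<close>
  moreover have "sum b (subtree i) \<le> k" if "h \<le> i" "Suc i < n" "i \<notin> ?I" "p i \<in> ?I" for i
  proof -
    have "Suc h \<le> i" "p i \<noteq> h" using that parent_greater[of i] by auto
    then show ?thesis using that t by blast
  qed
  moreover have "?I \<subseteq> {..u}" using t ph T by auto
  moreover have "h \<le> x \<and> p x \<in> ?I" if "x \<in> ?I" "x \<noteq> u" for x
    using that t T by (cases "x = h") (auto intro: Suc_leD)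
  ultimately show ?thesis using t unfolding traced_def by blast
qed

text \<open>At level 0, attainability of \<open>c x\<close> says \<open>c x = a x\<close>, so the
  conserved sum of the remaining weights becomes the weight of the set.\<close>

lemma traced_final:
  assumes "traced a b k u 0 I c" "u < n" "sum b {..<n} \<le> k + sum b (subtree u)"
  shows "top_safe b k u I" "sum a I = k"
proof -
  show "top_safe b k u I" using assms by (auto simp: traced_def top_safe_def)
  have "sum a I = sum c I" using assms by (intro sum.cong) (auto simp: traced_def)
  also have "\<dots> = k" using assms(1) by (simp only: traced_def)
  finally show "sum a I = k" .
qed

lemma sum_below_Suc:
  assumes "Suc h < n"
  shows "sum b (below (Suc h) v) = sum b (below h v) + (if p h = v then sum b (below h h) else 0)"
  using assms below_Suc[OF assms, of v] below_disjoint[OF assms, of v]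
  by (auto simp: sum.union_disjoint)

end

section \<open>Connected safe sets of undirected trees\<close>

text \<open>A path from inside \<open>A\<close> to the outside has a step that crosses the border.
  Symmetry of \<open>E\<close> absorbs the symmetric closure in the library's notion of
  connectivity.\<close>

lemma connected_imp_cut_connected:
  assumes "connected G" "arcs_ends G \<subseteq> E" "sym E"
  shows "cut_connected E (verts G)"
  unfolding cut_connected_def
proof (intro conjI allI impI)
  show "verts G \<noteq> {}" using assms(1) by (simp add: connected_conv)
  fix A assume A: "A \<subseteq> verts G" "A \<noteq> {}" "A \<noteq> verts G"
  then obtain u v where uv: "u \<in> A" "v \<in> verts G" "v \<notin> A" by auto
  then have "(u, v) \<in> rtrancl_on (verts G) ((arcs_ends G)\<^sup>s)"
    using assms(1) A by (auto simp: connected_conv)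
  then show "\<exists>x\<in>A. \<exists>y\<in>verts G - A. (x, y) \<in> E"
    using uv(1,3)
  proof (induction rule: rtrancl_on_induct)
    case (step y z)
    show ?case
    proof (cases "y \<in> A")
      case True
      have "(y, z) \<in> E" using step.hyps assms(2,3) by (auto simp: symcl_def sym_def)
      then show ?thesis using True step by blast
    qed (use step in blast)
  qed simp
qed

text \<open>The set of vertices reachable from \<open>u\<close> has no outgoing edge, so the cut
  property forces it to be everything.\<close>

lemma cut_connected_imp_connected:
  assumes "cut_connected E (verts G)" "E \<inter> verts G \<times> verts G \<subseteq> arcs_ends G"
  shows "connected G"
  unfolding connected_conv
proof (intro conjI ballI)
  show "verts G \<noteq> {}" using assms(1) by (simp add: cut_connected_def)
  fix u v assume u: "u \<in> verts G" and v: "v \<in> verts G"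
  define A where "A = {x \<in> verts G. (u, x) \<in> rtrancl_on (verts G) ((arcs_ends G)\<^sup>s)}"
  have uA: "u \<in> A" using u by (auto simp: A_def)
  have "A = verts G"
  proof (rule ccontr)
    assume "A \<noteq> verts G"
    moreover have "A \<subseteq> verts G" "A \<noteq> {}" using uA by (auto simp: A_def)
    ultimately obtain x y where xy: "x \<in> A" "y \<in> verts G - A" "(x, y) \<in> E"
      using assms(1) unfolding cut_connected_def by blast
    then have "(x, y) \<in> (arcs_ends G)\<^sup>s" using assms(2) by (auto simp: symcl_def A_def)
    then have "y \<in> A" using xy by (auto simp: A_def intro: rtrancl_on_into_rtrancl_on)
    then show False using xy by simp
  qed
  then show "(u, v) \<in> rtrancl_on (verts G) ((arcs_ends G)\<^sup>s)" using v by (auto simp: A_def)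
qed

lemma arcs_ends_with_proj_induce [simp]:
  "arcs_ends (with_proj T \<restriction> X) = parcs T \<inter> X \<times> X"
  by (auto simp: arcs_ends_def arc_to_ends_def image_iff)

lemma pair_graph_sym: "pair_graph T \<Longrightarrow> sym (parcs T)"
  using pair_sym_digraph.pair_sym_arcs[of T]
  by (auto simp: pair_graph_def pair_pseudo_graph_def symmetric_def)

lemma connected_induce_iff:
  assumes "pair_graph T"
  shows "connected (with_proj T \<restriction> X) \<longleftrightarrow> cut_connected (parcs T) X"
  using connected_imp_cut_connected[of "with_proj T \<restriction> X" "parcs T"] pair_graph_sym[OF assms]
    cut_connected_imp_connected[of "parcs T" "with_proj T \<restriction> X"] by auto

text \<open>A part without an outgoing edge cannot split \<open>X\<close> or \<open>Y\<close>, so it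
  would separate one from the other, which the link from \<open>x\<close> to \<open>y\<close>
  prevents.\<close>

lemma cut_connected_Un:
  assumes "cut_connected E X" "cut_connected E Y" "sym E" "x \<in> X" "y \<in> Y" "(x, y) \<in> E \<or> x = y"
  shows "cut_connected E (X \<union> Y)"
  unfolding cut_connected_def
proof (intro conjI allI impI)
  show "X \<union> Y \<noteq> {}" using assms by auto
  fix A assume A: "A \<subseteq> X \<union> Y" "A \<noteq> {}" "A \<noteq> X \<union> Y"
  show "\<exists>x\<in>A. \<exists>y\<in>X \<union> Y - A. (x, y) \<in> E"
  proof (rule ccontr)
    assume no: "\<not> ?thesis"
    have sides: "A \<inter> Z = {} \<or> Z \<subseteq> A" if "Z = X \<or> Z = Y" for Z
    proof (rule ccontr)
      assume "\<not> ?thesis"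
      then have "A \<inter> Z \<subseteq> Z" "A \<inter> Z \<noteq> {}" "A \<inter> Z \<noteq> Z" by auto
      moreover have "cut_connected E Z" using that assms by auto
      ultimately obtain v w where "v \<in> A \<inter> Z" "w \<in> Z - A \<inter> Z" "(v, w) \<in> E"
        unfolding cut_connected_def by meson
      then show False using no that by blast
    qed
    have "(x, y) \<in> E \<Longrightarrow> (y, x) \<in> E" using assms(3) by (auto dest: symD)
    then show False using sides[of X] sides[of Y] no A assms(4-6) by blast
  qed
qed

lemma cut_connected_singleton: "cut_connected E {x}"
  by (auto simp: cut_connected_def)

text \<open>Maximality among vertex sets suffices: a connected \<open>H\<close> in between has the
  vertex set \<open>D\<close>, and the induced subgraph already has all arcs on
  \<open>D\<close>.\<close>

lemma is_component_induceI:
  assumes T: "pair_graph T" and X: "X \<subseteq> pverts T" and D: "D \<subseteq> X" "cut_connected (parcs T) D"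
    and max: "\<And>D'. D \<subseteq> D' \<Longrightarrow> D' \<subseteq> X \<Longrightarrow> cut_connected (parcs T) D' \<Longrightarrow> D' = D"
  shows "is_component (with_proj T \<restriction> X) (with_proj T \<restriction> D)"
  unfolding is_component_def pre_digraph.max_subgraph_def
proof (intro conjI allI impI notI)
  interpret pair_graph T by fact
  have wf: "wf_digraph (with_proj T \<restriction> Y)" for Y by (rule wellformed_induce_subgraph)
  show "subgraph (with_proj T \<restriction> D) (with_proj T \<restriction> X)"
    using D(1) wf by (auto simp: subgraph_def compatible_def)
  show "connected (with_proj T \<restriction> D)" using D(2) connected_induce_iff[OF T] by simp
  fix H assume H: "H \<noteq> with_proj T \<restriction> D \<and> subgraph (with_proj T \<restriction> D) H"
    "subgraph H (with_proj T \<restriction> X) \<and> connected H"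
  have ends: "arcs_ends H \<subseteq> parcs T" using H(2)
    by (auto simp: subgraph_def compatible_def arcs_ends_def arc_to_ends_def)
  have "cut_connected (parcs T) (verts H)"
    using H(2) ends pair_graph_sym[OF T] by (intro connected_imp_cut_connected) auto
  moreover have "D \<subseteq> verts H" "verts H \<subseteq> X" using H by (auto simp: subgraph_def)
  ultimately have v: "verts H = D" using max by blast
  have "arcs H = arcs (with_proj T \<restriction> D)"
  proof
    show "arcs (with_proj T \<restriction> D) \<subseteq> arcs H" using H(1) by (auto simp: subgraph_def)
    have "wf_digraph H" using H(2) by (auto simp: subgraph_def)
    then have "tail H e \<in> D \<and> head H e \<in> D" if "e \<in> arcs H" for e
      using that v wf_digraph.tail_in_verts wf_digraph.head_in_verts by metis
    then show "arcs H \<subseteq> arcs (with_proj T \<restriction> D)"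
      using H(2) by (auto simp: subgraph_def compatible_def)
  qed
  moreover have "tail H = tail (with_proj T \<restriction> D)" "head H = head (with_proj T \<restriction> D)"
    using H(2) by (auto simp: subgraph_def compatible_def)
  ultimately have "H = with_proj T \<restriction> D" using v by (auto intro: pre_digraph.equality)
  then show False using H by simp
qed

lemma is_component_cut_connected:
  assumes "pair_graph T" "is_component (with_proj T \<restriction> X) C"
  shows "cut_connected (parcs T) (verts C)" "verts C \<subseteq> X"
proof -
  have C: "subgraph C (with_proj T \<restriction> X)" "connected C"
    using assms(2) by (auto simp: is_component_def pre_digraph.max_subgraph_def)
  then have "arcs_ends C \<subseteq> parcs T"
    by (auto simp: subgraph_def compatible_def arcs_ends_def arc_to_ends_def)
  then show "cut_connected (parcs T) (verts C)"
    using C(2) pair_graph_sym[OF assms(1)] by (intro connected_imp_cut_connected) auto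
  show "verts C \<subseteq> X" using C(1) by (auto simp: subgraph_def)
qed

lemma is_component_connected_eq:
  assumes "pair_graph T" "is_component (with_proj T \<restriction> X) C" "connected (with_proj T \<restriction> X)"
  shows "C = with_proj T \<restriction> X"
proof -
  interpret pair_graph T by fact
  have "wf_digraph (with_proj T \<restriction> X)" by (rule wellformed_induce_subgraph)
  then have "subgraph (with_proj T \<restriction> X) (with_proj T \<restriction> X)"
    by (auto simp: subgraph_def compatible_def)
  then show ?thesis
    using assms(2,3) unfolding is_component_def pre_digraph.max_subgraph_def by metis
qed

lemma undirected_tree_cut_connected:
  assumes T: "undirected_tree T"
  shows "cut_connected (parcs T) (pverts T)"
proof -
  have "pair_graph T" using T by (simp add: undirected_tree_def)
  then show ?thesis
    using T connected_imp_cut_connected[of "with_proj T" "parcs T"] pair_graph_sym[of T]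
    by (auto simp: undirected_tree_def arcs_ends_def arc_to_ends_def)
qed

text \<open>Every component of the complement is adjacent to \<open>S\<close>, so bounding the components amounts to
  bounding all connected sets that avoid \<open>S\<close>.\<close>

lemma connected_safe_set_iff:
  assumes T: "undirected_tree T"
  shows "connected_safe_set T wm wp S \<longleftrightarrow> cut_safe (parcs T) (pverts T) wm wp S"
proof -
  have G: "pair_graph T" using T by (simp add: undirected_tree_def)
  interpret pair_graph T by fact
  have sym: "sym (parcs T)" by (rule pair_graph_sym[OF G])
  have fin: "finite (pverts T)" by (rule pair_finite_verts)
  have V: "cut_connected (parcs T) (pverts T)" by (rule undirected_tree_cut_connected[OF T])
  show ?thesis
  proof
    assume L: "connected_safe_set T wm wp S"
    have S: "S \<subseteq> pverts T" using L by (simp add: connected_safe_set_def safe_set_def)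
    have con: "cut_connected (parcs T) S"
      using L connected_induce_iff[OF G] by (simp add: connected_safe_set_def)
    have "sum wp D \<le> sum wm S" if D: "D \<subseteq> pverts T - S" "cut_connected (parcs T) D" for D
    proof -
      \<comment> \<open>A maximal connected superset of \<open>D\<close> in the complement of
        \<open>S\<close> stands for the component that contains \<open>D\<close>.\<close>
      let ?F = "{D'. D \<subseteq> D' \<and> D' \<subseteq> pverts T - S \<and> cut_connected (parcs T) D'}"
      have "finite ?F" using fin by (intro finite_subset[of ?F "Pow (pverts T)"]) auto
      then obtain D' where D': "D' \<in> ?F" and max: "\<And>X. X \<in> ?F \<Longrightarrow> D' \<subseteq> X \<Longrightarrow> D' = X"
        using finite_has_maximal[of ?F] D
        by (metis (mono_tags, lifting) empty_iff mem_Collect_eq order_refl)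
      have max': "X = D'" if "D' \<subseteq> X" "X \<subseteq> pverts T - S" "cut_connected (parcs T) X" for X
        using max[of X] that D' by auto
      have comp: "is_component (with_proj T \<restriction> (pverts T - S)) (with_proj T \<restriction> D')"
        using D' max' by (intro is_component_induceI G) auto
      have compS: "is_component (with_proj T \<restriction> S) (with_proj T \<restriction> S)"
        using S con by (intro is_component_induceI G) auto
      have "S \<noteq> {}" "D' \<noteq> {}" using con D' by (auto simp: cut_connected_def)
      \<comment> \<open>Connectivity of the tree yields an edge out of \<open>D'\<close>, and by
        maximality its other end lies in \<open>S\<close>. This is the adjacency that the safety
        condition asks for.\<close>
      then have "D' \<subseteq> pverts T" "D' \<noteq> {}" "D' \<noteq> pverts T" using D' S by auto
      then obtain x y where xy: "x \<in> D'" "y \<in> pverts T - D'" "(x, y) \<in> parcs T"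
        using V unfolding cut_connected_def by meson
      have "y \<in> S"
      proof (rule ccontr)
        assume "y \<notin> S"
        moreover have "cut_connected (parcs T) (D' \<union> {y})"
          using D' xy sym by (intro cut_connected_Un[of _ _ _ x y]) (auto intro: cut_connected_singleton)
        ultimately have "D' \<union> {y} = D'" using xy D' by (intro max') auto
        then show False using xy by auto
      qed
      moreover have "(y, x) \<in> parcs T" using xy sym by (auto dest: symD)
      ultimately have "sum wp D' \<le> sum wm S"
        using L comp compS xy unfolding connected_safe_set_def safe_set_def
        by (metis induce_subgraph_verts)
      moreover have "sum wp D \<le> sum wp D'"
        using D' fin by (intro sum_mono2) (auto intro: finite_subset)
      ultimately show ?thesis by simp
    qed
    then show "cut_safe (parcs T) (pverts T) wm wp S" using S con by (simp add: cut_safe_def)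
  next
    assume R: "cut_safe (parcs T) (pverts T) wm wp S"
    then have con: "connected (with_proj T \<restriction> S)"
      using connected_induce_iff[OF G] by (simp add: cut_safe_def)
    have "sum wp (verts D) \<le> sum wm (verts C)"
      if C: "is_component (with_proj T \<restriction> S) C" and D: "is_component (with_proj T \<restriction> (pverts T - S)) D"
      for C D
    proof -
      have "verts C = S" using is_component_connected_eq[OF G C con] by simp
      then show ?thesis using is_component_cut_connected[OF G D] R unfolding cut_safe_def by metis
    qed
    then show "connected_safe_set T wm wp S"
      using con R by (auto simp: connected_safe_set_def safe_set_def cut_safe_def)
  qed
qed

section \<open>Peeling off leaves\<close>

definition nbrs :: "('a \<times> 'a) set \<Rightarrow> 'a set \<Rightarrow> 'a \<Rightarrow> 'a set" where
  "nbrs E R x = {y \<in> R. (x, y) \<in> E}"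

lemma finite_nbrs [simp]: "finite R \<Longrightarrow> finite (nbrs E R x)"
  by (simp add: nbrs_def)

lemma nbrs_nonempty:
  assumes "cut_connected E R" "x \<in> R" "R \<noteq> {x}"
  shows "nbrs E R x \<noteq> {}"
  using assms(1)[unfolded cut_connected_def, THEN conjunct2, rule_format, of "{x}"] assms(2,3)
  by (auto simp: nbrs_def)

text \<open>Put \<open>x\<close> on the side of its only neighbour \<open>y\<close>. The extended
  cut \<open>A'\<close> of \<open>R\<close> is crossed by an edge, this edge cannot meet
  \<open>x\<close>, and so it crosses \<open>A\<close>.\<close>

lemma cut_connected_remove_leaf:
  assumes con: "cut_connected E R" and sym: "sym E" and x: "nbrs E R x = {y}" and irr: "(x, x) \<notin> E"
  shows "cut_connected E (R - {x})"
  unfolding cut_connected_def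
proof (intro conjI allI impI)
  have y: "y \<in> R" "(x, y) \<in> E" "y \<noteq> x" using x irr by (auto simp: nbrs_def)
  then show "R - {x} \<noteq> {}" by auto
  fix A assume A: "A \<subseteq> R - {x}" "A \<noteq> {}" "A \<noteq> R - {x}"
  have only: "z = y" if "z \<in> R" "(x, z) \<in> E \<or> (z, x) \<in> E" for z
    using that x sym by (auto simp: nbrs_def dest: symD)
  define A' where "A' = (if y \<in> A then insert x A else A)"
  show "\<exists>v\<in>A. \<exists>w\<in>R - {x} - A. (v, w) \<in> E"
  proof (cases "x \<in> R")
    case True
    then have "A' \<subseteq> R" "A' \<noteq> {}" "A' \<noteq> R" using A y by (auto simp: A'_def)
    then obtain v w where "v \<in> A'" "w \<in> R - A'" "(v, w) \<in> E"
      using con unfolding cut_connected_def by meson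
    note vw = this
    have "v \<noteq> x"
    proof
      assume "v = x"
      then have "y \<in> A" "w = y" using vw A only[of w] by (auto simp: A'_def split: if_splits)
      then show False using vw by (simp add: A'_def)
    qed
    moreover have "w \<noteq> x"
    proof
      assume "w = x"
      then have "y \<notin> A" "v = y" using vw \<open>A' \<subseteq> R\<close> only[of v] by (auto simp: A'_def split: if_splits)
      then show False using vw by (simp add: A'_def)
    qed
    ultimately have "v \<in> A" "w \<in> R - {x} - A" using vw by (auto simp: A'_def split: if_splits)
    then show ?thesis using vw(3) by blast
  next
    case False
    then show ?thesis using A con unfolding cut_connected_def by (metis Diff_empty Diff_insert0)
  qed
qed

section \<open>Existence of leaves and the number of edges\<close>

fun walk :: "('a \<times> 'a) set \<Rightarrow> 'a list \<Rightarrow> bool" where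
  "walk E (x # y # zs) \<longleftrightarrow> (x, y) \<in> E \<and> walk E (y # zs)"
| "walk E _ \<longleftrightarrow> True"

lemma walk_take: "walk E xs \<Longrightarrow> walk E (take m xs)"
proof (induction E xs arbitrary: m rule: walk.induct)
  case (1 E x y zs)
  show ?case
  proof (cases m)
    case (Suc m')
    then show ?thesis using 1(1)[of m'] 1(2) by (cases m') auto
  qed simp
qed (auto simp: take_Cons split: nat.splits)

text \<open>Paths are kept as vertex lists, for which prolonging and truncating are list operations;
  they are turned into the arc lists of the library only to exhibit a cycle.\<close>

lemma walk_awalk:
  assumes "pair_wf_digraph T"
  shows "xs \<noteq> [] \<Longrightarrow> set xs \<subseteq> pverts T \<Longrightarrow> walk (parcs T) xs \<Longrightarrow>
    \<exists>p. pre_digraph.awalk (with_proj T) (hd xs) p (last xs) \<and>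
        pre_digraph.awalk_verts (with_proj T) (hd xs) p = xs \<and> length p = length xs - 1"
proof (induction "parcs T" xs rule: walk.induct)
  interpret pair_wf_digraph T by fact
  case (1 x y zs)
  then obtain p where p: "awalk y p (last (y # zs))" "awalk_verts y p = y # zs"
    "length p = length zs" by auto
  then show ?case using 1
    by (intro exI[of _ "(x, y) # p"]) (auto simp: awalk_Cons_iff)
next
  interpret pair_wf_digraph T by fact
  case ("2_2" x)
  then show ?case by (intro exI[of _ "[]"]) (auto simp: awalk_Nil_iff)
qed auto

text \<open>The first vertex of a longest path has no neighbours but its successor: another one would
  lie on the path and close a cycle.\<close>

lemma low_degree_vertex:
  assumes T: "undirected_tree T" and R: "R \<subseteq> pverts T" "R \<noteq> {}"
  shows "\<exists>x\<in>R. card (nbrs (parcs T) R x) \<le> 1"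
proof (rule ccontr)
  assume no: "\<not> ?thesis"
  have G: "pair_graph T" using T by (simp add: undirected_tree_def)
  interpret pair_graph T by fact
  have finR: "finite R" using finite_subset[OF R(1)] pair_finite_verts by blast
  let ?P = "\<lambda>xs. xs \<noteq> [] \<and> distinct xs \<and> set xs \<subseteq> R \<and> walk (parcs T) xs"
  obtain r where "r \<in> R" using R by auto
  then have "?P [r]" by auto
  moreover have "\<forall>xs. ?P xs \<longrightarrow> length xs < Suc (card R)"
    using card_mono[OF finR] distinct_card by (metis less_Suc_eq_le)
  ultimately obtain xs where xs: "?P xs" and max: "\<And>ys. ?P ys \<Longrightarrow> length ys \<le> length xs"
    using ex_has_greatest_nat[of ?P "[r]" length "Suc (card R)"] by blast
  define x where "x = hd xs"
  have x: "x \<in> R" using xs by (auto simp: x_def)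
  have c2: "\<not> card (nbrs (parcs T) R x) \<le> 1" using no x by blast
  \<comment> \<open>If \<open>xs\<close> has length 1, \<open>xs ! 1\<close> is unspecified. This is
    harmless: of at least two neighbours one differs from any given value.\<close>
  have "\<not> nbrs (parcs T) R x \<subseteq> {xs ! 1}"
  proof
    assume "nbrs (parcs T) R x \<subseteq> {xs ! 1}"
    then have "card (nbrs (parcs T) R x) \<le> card {xs ! 1}" by (intro card_mono) auto
    then show False using c2 by simp
  qed
  then obtain y where y: "y \<in> R" "(x, y) \<in> parcs T" "y \<noteq> xs ! 1" by (auto simp: nbrs_def)
  have yx: "(y, x) \<in> parcs T" using pair_graph_sym[OF G] y by (auto dest: symD)
  have neq: "y \<noteq> x" using y pair_no_loops[of "(x, y)"] by auto
  have "y \<in> set xs"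
  proof (rule ccontr)
    assume "y \<notin> set xs"
    then have "?P (y # xs)" using xs y yx by (cases xs) (auto simp: x_def)
    then show False using max by fastforce
  qed
  then obtain m where m: "m < length xs" "xs ! m = y" by (auto simp: in_set_conv_nth)
  \<comment> \<open>The arc from \<open>y\<close> to \<open>x\<close> closes a segment of
    \<open>m\<close> arcs, so \<open>2 \<le> m\<close> yields the length of at least three that
    \<open>undirected_tree\<close> forbids; a mere pair of opposite arcs is thereby ruled
    out.\<close>
  have m2: "2 \<le> m"
  proof (rule ccontr)
    assume "\<not> 2 \<le> m"
    then have "m = 0 \<or> m = 1" by auto
    then show False using m y neq xs by (auto simp: x_def hd_conv_nth)
  qed
  let ?ys = "take (Suc m) xs"
  have ne: "?ys \<noteq> []" using xs by simp
  have last: "last ?ys = y" using m by (simp add: take_Suc_conv_app_nth)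
  have hd: "hd ?ys = x" using xs by (simp add: x_def)
  have sub: "set ?ys \<subseteq> pverts T" using xs R set_take_subset by fast
  obtain p where p: "awalk x p y" "awalk_verts x p = ?ys" "length p = length ?ys - 1"
    using walk_awalk[OF pair_wf_digraph, of ?ys] ne sub walk_take[of "parcs T" xs "Suc m"] xs hd last
    unfolding awalk_verts_with_proj_eq by auto
  have "awalk y ((y, x) # p) y" using p(1) yx by (auto simp: awalk_Cons_iff)
  moreover have "distinct (tl (awalk_verts y ((y, x) # p)))" using p(2) xs by (simp add: distinct_take)
  ultimately have "cycle ((y, x) # p)" unfolding cycle_def by blast
  moreover have "3 \<le> length ((y, x) # p)" using p(3) m m2 by auto
  ultimately show False using T unfolding undirected_tree_def by blast
qed

text \<open>Deleting a vertex of degree at most one costs at most one edge. The bound serves the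
  running time of the loop over the edge list; with \<open>card R\<close> instead of
  \<open>card R - 1\<close> the induction can start at the empty set.\<close>

lemma card_edges_le:
  assumes T: "undirected_tree T"
  shows "finite R \<Longrightarrow> R \<subseteq> pverts T \<Longrightarrow>
    finite {{u, v} |u v. (u, v) \<in> parcs T \<and> u \<in> R \<and> v \<in> R} \<and>
    card {{u, v} |u v. (u, v) \<in> parcs T \<and> u \<in> R \<and> v \<in> R} \<le> card R"
proof (induction "card R" arbitrary: R)
  case 0
  then show ?case by simp
next
  case (Suc m)
  let ?e = "\<lambda>R. {{u, v} |u v. (u, v) \<in> parcs T \<and> u \<in> R \<and> v \<in> R}"
  have G: "pair_graph T" using T by (simp add: undirected_tree_def)
  have ne: "R \<noteq> {}" using Suc.hyps(2) by auto
  obtain x where x: "x \<in> R" "card (nbrs (parcs T) R x) \<le> 1"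
    using low_degree_vertex[OF T Suc.prems(2) ne] by auto
  have IH: "finite (?e (R - {x})) \<and> card (?e (R - {x})) \<le> card (R - {x})"
    using Suc x by (intro Suc.hyps(1)) auto
  have sub: "?e R \<subseteq> ?e (R - {x}) \<union> (\<lambda>y. {x, y}) ` nbrs (parcs T) R x" (is "_ \<subseteq> ?U")
  proof
    fix e assume "e \<in> ?e R"
    then obtain u v where uv: "e = {u, v}" "(u, v) \<in> parcs T" "u \<in> R" "v \<in> R" by auto
    have "(v, u) \<in> parcs T" using uv pair_graph_sym[OF G] by (auto dest: symD)
    then show "e \<in> ?U" using uv by (cases "u = x"; cases "v = x") (auto simp: nbrs_def)
  qed
  have fU: "finite ?U" using IH Suc.prems by auto
  have "card (?e R) \<le> card ?U" using sub fU by (rule card_mono[rotated])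
  also have "\<dots> \<le> card (?e (R - {x})) + card ((\<lambda>y. {x, y}) ` nbrs (parcs T) R x)" by (rule card_Un_le)
  also have "\<dots> \<le> card (R - {x}) + 1"
    using IH x(2) card_image_le[OF finite_nbrs[OF Suc.prems(1)], of "\<lambda>y. {x, y}" "parcs T" x] by linarith
  also have "\<dots> = card R" using x by (simp add: Suc.hyps(2)[symmetric])
  finally show ?case using fU sub finite_subset by blast
qed

lemma length_edge_list_le:
  assumes T: "undirected_tree T" and es: "is_edge_list T es"
  shows "length es \<le> card (pverts T)"
proof -
  interpret pair_graph T using T by (simp add: undirected_tree_def)
  let ?E = "{{u, v} |u v. (u, v) \<in> parcs T \<and> u \<in> pverts T \<and> v \<in> pverts T}"
  have "finite ?E \<and> card ?E \<le> card (pverts T)"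
    using pair_finite_verts by (intro card_edges_le[OF T]) auto
  moreover have "set (map (\<lambda>(u, v). {u, v}) es) \<subseteq> ?E"
  proof
    fix e assume "e \<in> set (map (\<lambda>(u, v). {u, v}) es)"
    then obtain u v where uv: "e = {u, v}" "(u, v) \<in> set es" by auto
    then have "(u, v) \<in> parcs T" using es by (simp add: is_edge_list_def)
    then show "e \<in> ?E" using uv in_arcsD1[of u v] in_arcsD2[of u v] by blast
  qed
  ultimately have "card (set (map (\<lambda>(u, v). {u, v}) es)) \<le> card (pverts T)"
    by (meson card_mono order_trans)
  then show ?thesis using es distinct_card[of "map (\<lambda>(u, v). {u, v}) es"] by (simp add: is_edge_list_def)
qed

text \<open>The listed edges at \<open>v\<close> split by the end at which \<open>v\<close> stands.
  With \<open>g\<close> constantly 1 the sum is the degree, with \<open>g\<close> the identity it is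
  the sum of the neighbours: the two quantities that peeling maintains.\<close>

lemma sum_edge_list:
  assumes T: "pair_graph T" and es: "is_edge_list T es"
  shows "(\<Sum>i<length es. (if fst (es ! i) = v then g (snd (es ! i)) else 0) +
      (if snd (es ! i) = v then g (fst (es ! i)) else 0)) = (\<Sum>y\<in>nbrs (parcs T) (pverts T) v. (g y :: nat))"
proof -
  interpret pair_graph T by fact
  let ?f = "\<lambda>e. (if fst e = v then g (snd e) else 0) + (if snd e = v then g (fst e) else 0)"
  have dist: "distinct es" using es by (auto simp: is_edge_list_def distinct_map)
  have inj: "inj_on (\<lambda>(u, v). {u, v}) (set es)" using es by (simp add: is_edge_list_def distinct_map)
  have P: "parcs T = set es \<union> (set es)\<inverse>" using es by (simp add: is_edge_list_def)
  let ?A = "{y. (v, y) \<in> set es}" and ?B = "{y. (y, v) \<in> set es}"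
  have fA: "finite ?A" by (rule finite_subset[of _ "snd ` set es"]) force+
  have fB: "finite ?B" by (rule finite_subset[of _ "fst ` set es"]) force+
  \<comment> \<open>If both orientations were listed, they would be one and the same entry, and the
    edge would be a loop.\<close>
  have "y \<notin> ?B" if "y \<in> ?A" for y
  proof
    assume "y \<in> ?B"
    then have "(v, y) = (y, v)" using that inj_onD[OF inj, of "(v, y)" "(y, v)"] by auto
    from arg_cong[OF this, of fst] have "v = y" by (simp only: fst_conv)
    then have "(v, v) \<in> parcs T" using that unfolding P by simp
    then show False using pair_no_loops[of "(v, v)"] by simp
  qed
  then have disj: "?A \<inter> ?B = {}" by auto
  have nb: "nbrs (parcs T) (pverts T) v = ?A \<union> ?B"
    using P in_arcsD1 in_arcsD2 by (fastforce simp: nbrs_def)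
  have "(\<Sum>i<length es. ?f (es ! i)) = sum ?f (set es)"
    using dist by (simp add: sum_list_sum_nth[symmetric, of "map ?f es", simplified] sum_list_distinct_conv_sum_set lessThan_atLeast0)
  also have "\<dots> = (\<Sum>e\<in>set es. if fst e = v then g (snd e) else 0) + (\<Sum>e\<in>set es. if snd e = v then g (fst e) else 0)"
    by (rule sum.distrib)
  also have "(\<Sum>e\<in>set es. if fst e = v then g (snd e) else 0) = (\<Sum>e\<in>{e \<in> set es. fst e = v}. g (snd e))"
    by (simp add: sum.inter_filter)
  also have "{e \<in> set es. fst e = v} = Pair v ` ?A" by force
  also have "(\<Sum>e\<in>Pair v ` ?A. g (snd e)) = sum g ?A" by (subst sum.reindex) (auto simp: inj_on_def)
  also have "(\<Sum>e\<in>set es. if snd e = v then g (fst e) else 0) = (\<Sum>e\<in>{e \<in> set es. snd e = v}. g (fst e))"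
    by (simp add: sum.inter_filter)
  also have "{e \<in> set es. snd e = v} = (\<lambda>y. (y, v)) ` ?B" by force
  also have "(\<Sum>e\<in>(\<lambda>y. (y, v)) ` ?B. g (fst e)) = sum g ?B" by (subst sum.reindex) (auto simp: inj_on_def)
  also have "sum g ?A + sum g ?B = sum g (?A \<union> ?B)" using fA fB disj by (simp add: sum.union_disjoint)
  finally show ?thesis using nb by simp
qed

section \<open>Transport of cuts and safety along a relabelling of the vertices\<close>

lemma cut_connected_image:
  assumes inj: "inj_on q V" and E: "E \<subseteq> V \<times> V" and X: "X \<subseteq> V"
  shows "cut_connected (map_prod q q ` E) (q ` X) \<longleftrightarrow> cut_connected E X"
proof -
  have edge: "(q x, q y) \<in> map_prod q q ` E \<longleftrightarrow> (x, y) \<in> E" if "x \<in> V" "y \<in> V" for x y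
  proof
    assume "(q x, q y) \<in> map_prod q q ` E"
    then obtain x' y' where "(x', y') \<in> E" "q x = q x'" "q y = q y'" by auto
    moreover from this have "x' \<in> V" "y' \<in> V" using E by auto
    ultimately show "(x, y) \<in> E" using inj that by (metis inj_onD)
  qed force
  have mem: "q x \<in> q ` A \<longleftrightarrow> x \<in> A" if "x \<in> V" "A \<subseteq> V" for x A
    using that inj by (meson inj_on_image_mem_iff)
  have "(\<forall>A. A \<subseteq> q ` X \<longrightarrow> A \<noteq> {} \<longrightarrow> A \<noteq> q ` X \<longrightarrow> (\<exists>x\<in>A. \<exists>y\<in>q ` X - A. (x, y) \<in> map_prod q q ` E)) \<longleftrightarrow>
    (\<forall>A. A \<subseteq> X \<longrightarrow> A \<noteq> {} \<longrightarrow> A \<noteq> X \<longrightarrow> (\<exists>x\<in>A. \<exists>y\<in>X - A. (x, y) \<in> E))" (is "?L \<longleftrightarrow> ?R")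
  proof
    assume L: ?L
    show ?R
    proof (intro allI impI)
      fix A assume A: "A \<subseteq> X" "A \<noteq> {}" "A \<noteq> X"
      then have "q ` A \<noteq> q ` X" using inj X by (metis inj_on_image_eq_iff order_trans)
      then have "\<exists>x\<in>q ` A. \<exists>y\<in>q ` X - q ` A. (x, y) \<in> map_prod q q ` E"
        using A by (intro L[rule_format]) auto
      then obtain x y where xy: "x \<in> A" "y \<in> X" "q y \<notin> q ` A" "(q x, q y) \<in> map_prod q q ` E"
        by (metis DiffD1 DiffD2 imageE)
      have "x \<in> V" "y \<in> V" "y \<notin> A" using xy A X by auto
      then have "(x, y) \<in> E" "y \<in> X - A" using edge[of x y] xy by auto
      then show "\<exists>x\<in>A. \<exists>y\<in>X - A. (x, y) \<in> E" using xy(1) by blast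
    qed
  next
    assume R: ?R
    show ?L
    proof (intro allI impI)
      fix B assume B: "B \<subseteq> q ` X" "B \<noteq> {}" "B \<noteq> q ` X"
      then obtain A where A: "A \<subseteq> X" "B = q ` A" by (meson subset_imageE)
      then have "\<exists>x\<in>A. \<exists>y\<in>X - A. (x, y) \<in> E" using R B by blast
      then obtain x y where xy: "x \<in> A" "y \<in> X" "y \<notin> A" "(x, y) \<in> E" by blast
      have "x \<in> V" "y \<in> V" "A \<subseteq> V" using xy A X by auto
      then have "q x \<in> B" "q y \<in> q ` X - B" "(q x, q y) \<in> map_prod q q ` E"
        using edge mem xy A by auto
      then show "\<exists>x\<in>B. \<exists>y\<in>q ` X - B. (x, y) \<in> map_prod q q ` E"
        by (intro bexI[of _ "q x"] bexI[of _ "q y"])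
    qed
  qed
  then show ?thesis unfolding cut_connected_def by simp
qed

lemma cut_safe_image:
  assumes q: "bij_betw q V V'" and E: "E \<subseteq> V \<times> V" and S: "S \<subseteq> V"
  shows "cut_safe (map_prod q q ` E) V' a b (q ` S) \<longleftrightarrow> cut_safe E V (a \<circ> q) (b \<circ> q) S"
proof -
  have inj: "inj_on q V" and V': "V' = q ` V" using q by (auto simp: bij_betw_def)
  have sum: "sum f (q ` X) = sum (f \<circ> q) X" if "X \<subseteq> V" for X and f :: "_ \<Rightarrow> nat"
    using inj that by (metis inj_on_subset sum.reindex)
  have diff: "V' - q ` S = q ` (V - S)" using inj S V' by (simp add: inj_on_image_set_diff)
  have "(\<forall>D. D \<subseteq> V' - q ` S \<longrightarrow> cut_connected (map_prod q q ` E) D \<longrightarrow> sum b D \<le> sum a (q ` S)) \<longleftrightarrow>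
    (\<forall>D. D \<subseteq> V - S \<longrightarrow> cut_connected E D \<longrightarrow> sum (b \<circ> q) D \<le> sum (a \<circ> q) S)" (is "?L \<longleftrightarrow> ?R")
  proof
    assume L: ?L
    show ?R
    proof (intro allI impI)
      fix D assume D: "D \<subseteq> V - S" "cut_connected E D"
      then have "cut_connected (map_prod q q ` E) (q ` D)"
        using cut_connected_image[OF inj E, of D] by auto
      moreover have "q ` D \<subseteq> V' - q ` S" using D diff by auto
      ultimately have "sum b (q ` D) \<le> sum a (q ` S)" using L by blast
      moreover have "D \<subseteq> V" using D by auto
      ultimately show "sum (b \<circ> q) D \<le> sum (a \<circ> q) S" using sum S by metis
    qed
  next
    assume R: ?R
    show ?L
    proof (intro allI impI)
      fix D' assume D': "D' \<subseteq> V' - q ` S" "cut_connected (map_prod q q ` E) D'"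
      then obtain D where D: "D \<subseteq> V - S" "D' = q ` D" unfolding diff by (meson subset_imageE)
      then have DV: "D \<subseteq> V" by auto
      then have "cut_connected E D" using D' D cut_connected_image[OF inj E, of D] by auto
      then show "sum b D' \<le> sum a (q ` S)" using R D sum[OF DV] sum[OF S] by auto
    qed
  qed
  moreover have "q ` S \<subseteq> V'" using S V' by auto
  ultimately show ?thesis unfolding cut_safe_def using S cut_connected_image[OF inj E S] by simp
qed

section \<open>Total correctness with running times\<close>

text \<open>By \<open>exec_deterministic\<close> a halting run is unique, so this is a weakest
  precondition for total correctness, with the running time as an extra argument of
  \<open>Q\<close>.\<close>

definition runs :: "com \<Rightarrow> state \<Rightarrow> (nat \<Rightarrow> state \<Rightarrow> bool) \<Rightarrow> bool" where
  "runs c s Q \<longleftrightarrow> (\<exists>t s'. exec c s t s' \<and> Q t s')"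

lemma runs_Skip: "runs Skip s Q \<longleftrightarrow> Q 1 s"
  unfolding runs_def by (metis SkipE exec.Skip)

lemma runs_Write:
  "runs (Write a i e) s Q \<longleftrightarrow> Q (1 + acost i + acost e) (s(a := (s a)(aval i s := aval e s)))"
  unfolding runs_def by (metis WriteE exec.Write)

lemma runs_Seq: "runs (Seq c d) s Q \<longleftrightarrow> runs c s (\<lambda>t s'. runs d s' (\<lambda>u. Q (t + u)))"
  unfolding runs_def by (metis SeqE exec.Seq)

lemma runs_Cond:
  "runs (Cond b c d) s Q \<longleftrightarrow>
    (if bval b s then runs c s (\<lambda>t. Q (1 + bcost b + t)) else runs d s (\<lambda>t. Q (1 + bcost b + t)))"
proof
  assume "runs (Cond b c d) s Q"
  then obtain t s' where "exec (Cond b c d) s t s'" "Q t s'" by (auto simp: runs_def)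
  then show "if bval b s then runs c s (\<lambda>t. Q (1 + bcost b + t))
      else runs d s (\<lambda>t. Q (1 + bcost b + t))"
    by (elim CondE) (auto simp: runs_def)
next
  assume "if bval b s then runs c s (\<lambda>t. Q (1 + bcost b + t)) else runs d s (\<lambda>t. Q (1 + bcost b + t))"
  then show "runs (Cond b c d) s Q"
    unfolding runs_def by (metis exec.CondTrue exec.CondFalse)
qed

lemmas runs_simps = runs_Skip runs_Write runs_Seq runs_Cond

lemma runs_mono: "runs c s Q \<Longrightarrow> (\<And>t s'. Q t s' \<Longrightarrow> Q' t s') \<Longrightarrow> runs c s Q'"
  unfolding runs_def by blast

lemma runs_SeqI:
  assumes "runs c s (\<lambda>t s'. t \<le> B \<and> P s')"
    and "\<And>s'. P s' \<Longrightarrow> runs d s' (\<lambda>t s''. t \<le> C \<and> Q s'')" and "B + C \<le> D"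
  shows "runs (Seq c d) s (\<lambda>t s'. t \<le> D \<and> Q s')"
  unfolding runs_Seq
proof (rule runs_mono[OF assms(1)])
  fix t s' assume *: "t \<le> B \<and> P s'"
  then have "runs d s' (\<lambda>t s''. t \<le> C \<and> Q s'')" using assms(2) by simp
  then show "runs d s' (\<lambda>u s'. t + u \<le> D \<and> Q s')"
    by (rule runs_mono) (use * assms(3) in auto)
qed

primrec writes :: "com \<Rightarrow> string set" where
  "writes Skip = {}"
| "writes (Write a i e) = {a}"
| "writes (Seq c d) = writes c \<union> writes d"
| "writes (Cond b c d) = writes c \<union> writes d"
| "writes (While b c) = writes c"

lemma exec_frame: "exec c s t s' \<Longrightarrow> a \<notin> writes c \<Longrightarrow> s' a = s a"
  by (induction rule: exec.induct) auto

text \<open>The number \<open>N\<close> of rounds is known in advance, so \<open>I\<close> is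
  indexed by the round, which also takes the place of a variant. Arrays outside
  \<open>writes c\<close> are tracked by the rule itself, and \<open>I\<close> need mention only the
  others.\<close>

lemma runs_While:
  assumes I: "I 0 s"
    and step: "\<And>m s'. m < N \<Longrightarrow> I m s' \<Longrightarrow> (\<And>a. a \<notin> writes c \<Longrightarrow> s' a = s a) \<Longrightarrow>
      bval b s' \<and> runs c s' (\<lambda>t s''. t \<le> B \<and> I (Suc m) s'')"
    and exit: "\<And>s'. I N s' \<Longrightarrow> (\<And>a. a \<notin> writes c \<Longrightarrow> s' a = s a) \<Longrightarrow> \<not> bval b s'"
    and T: "N * (1 + bcost b + B) + 1 + bcost b \<le> T"
  shows "runs (While b c) s (\<lambda>t s'. t \<le> T \<and> I N s' \<and> (\<forall>a. a \<notin> writes c \<longrightarrow> s' a = s a))"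
proof -
  have "m \<le> N \<Longrightarrow> I m s' \<Longrightarrow> (\<And>a. a \<notin> writes c \<Longrightarrow> s' a = s a) \<Longrightarrow>
    \<exists>t s''. exec (While b c) s' t s'' \<and> t \<le> (N - m) * (1 + bcost b + B) + 1 + bcost b \<and> I N s'' \<and>
      (\<forall>a. a \<notin> writes c \<longrightarrow> s'' a = s a)" for m s'
  proof (induction "N - m" arbitrary: m s')
    case 0
    then have [simp]: "m = N" by simp
    have "exec (While b c) s' (1 + bcost b) s'" using exit[of s'] 0 by (intro exec.WhileFalse) auto
    then show ?case using 0 by (intro exI[of _ "1 + bcost b"] exI[of _ s']) auto
  next
    case (Suc d)
    then have m: "m < N" by simp
    obtain t r where r: "bval b s'" "exec c s' t r" "t \<le> B" "I (Suc m) r"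
      using step[OF m Suc(4) Suc(5)] unfolding runs_def by blast
    have fr: "r a = s a" if "a \<notin> writes c" for a
      using exec_frame[OF r(2) that] Suc(5)[OF that] by simp
    have "d = N - Suc m" "Suc m \<le> N" using Suc(2) m by auto
    then obtain u s'' where u: "exec (While b c) r u s''"
      "u \<le> (N - Suc m) * (1 + bcost b + B) + 1 + bcost b" "I N s''" "\<forall>a. a \<notin> writes c \<longrightarrow> s'' a = s a"
      using Suc(1)[of "Suc m" r] r(4) fr by blast
    have e: "exec (While b c) s' (1 + bcost b + t + u) s''"
      using exec.WhileTrue[OF r(1,2) u(1)] .
    have "N - m = Suc (N - Suc m)" using m by simp
    then have "1 + bcost b + t + u \<le> (N - m) * (1 + bcost b + B) + 1 + bcost b"
      using u(2) r(3) by simp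
    then show ?case using e u by blast
  qed
  from this[of 0 s] I T show ?thesis unfolding runs_def by fastforce
qed

abbreviation var :: "string \<Rightarrow> aexp" where "var x \<equiv> Read x (Const 0)"
abbreviation assign :: "string \<Rightarrow> aexp \<Rightarrow> com" where "assign x e \<equiv> Write x (Const 0) e"
abbreviation incr :: "string \<Rightarrow> com" where "incr x \<equiv> assign x (Plus (var x) (Const 1))"
abbreviation seq :: "com \<Rightarrow> com \<Rightarrow> com" (infixr \<open>;;\<close> 60) where "c ;; d \<equiv> Seq c d"

section \<open>The peeling phase\<close>

text \<open>\<open>deg\<close> and \<open>ns\<close> hold the number and the sum of the remaining neighbours. At a leaf the
  latter is its only neighbour, so no adjacency lists are needed. Edges are
  loop-free, whereas cells beyond the input are \<open>0\<close>: equal endpoints mark the end of the edge list.\<close>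

definition degree_loop :: com where
  "degree_loop = While (Neg (Eq (Read ''src'' (var ''e'')) (Read ''dst'' (var ''e''))))
    (assign ''x'' (Read ''src'' (var ''e'')) ;;
     assign ''y'' (Read ''dst'' (var ''e'')) ;;
     Write ''deg'' (var ''x'') (Plus (Read ''deg'' (var ''x'')) (Const 1)) ;;
     Write ''deg'' (var ''y'') (Plus (Read ''deg'' (var ''y'')) (Const 1)) ;;
     Write ''ns'' (var ''x'') (Plus (Read ''ns'' (var ''x'')) (var ''y'')) ;;
     Write ''ns'' (var ''y'') (Plus (Read ''ns'' (var ''y'')) (var ''x'')) ;;
     incr ''e'')"

definition edge_sum :: "(nat \<Rightarrow> nat) \<Rightarrow> (nat \<times> nat) list \<Rightarrow> nat \<Rightarrow> nat \<Rightarrow> nat" where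
  "edge_sum g es m v = (\<Sum>i<m. (if fst (es ! i) = v then g (snd (es ! i)) else 0) +
      (if snd (es ! i) = v then g (fst (es ! i)) else 0))"

lemma runs_degree_loop:
  assumes "\<And>i. i < length es \<Longrightarrow> s ''src'' i = fst (es ! i) \<and> s ''dst'' i = snd (es ! i)"
    and "\<And>i. i < length es \<Longrightarrow> fst (es ! i) \<noteq> snd (es ! i)"
    and "s ''src'' (length es) = s ''dst'' (length es)"
    and "s ''deg'' = (\<lambda>_. 0)" "s ''ns'' = (\<lambda>_. 0)" "s ''e'' 0 = 0"
  shows "runs degree_loop s (\<lambda>t s'. t \<le> length es * 60 + 60 \<and>
    s' ''deg'' = edge_sum (\<lambda>_. 1) es (length es) \<and> s' ''ns'' = edge_sum (\<lambda>y. y) es (length es) \<and>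
    (\<forall>a. a \<notin> {''x'', ''y'', ''e'', ''deg'', ''ns''} \<longrightarrow> s' a = s a))"
  unfolding degree_loop_def
  apply (rule runs_mono)
   \<comment> \<open>\<open>B\<close> bounds one round of the body and \<open>T\<close> the whole
     loop; here and in the later loops the constants are rounded up.\<close>
   apply (rule runs_While[where N = "length es" and B = 50 and T = "length es * 60 + 60" and
        I = "\<lambda>m s'. s' ''e'' 0 = m \<and> s' ''deg'' = edge_sum (\<lambda>_. 1) es m \<and> s' ''ns'' = edge_sum (\<lambda>y. y) es m"])
  subgoal using assms by (simp add: edge_sum_def fun_eq_iff)
  subgoal for m s'
    using assms(1,2)[of m] by (auto simp: runs_simps edge_sum_def fun_eq_iff)
  subgoal using assms(3) by simp
  subgoal by simp
  subgoal by auto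
  done

definition queue_loop :: com where
  "queue_loop = While (Less (var ''i'') (var ''n''))
    (Cond (Less (Read ''deg'' (var ''i'')) (Const 2))
       (Write ''q'' (var ''t'') (var ''i'') ;; incr ''t'') Skip ;;
     incr ''i'')"

lemma inj_on_push:
  fixes t :: nat
  assumes "inj_on q {..<t}" "v \<notin> q ` {..<t}"
  shows "inj_on (q(t := v)) {..<Suc t}" "q(t := v) ` {..<Suc t} = insert v (q ` {..<t})"
proof -
  have *: "q(t := v) ` {..<t} = q ` {..<t}" by (intro image_cong) auto
  show "inj_on (q(t := v)) {..<Suc t}"
    using assms * by (auto simp: lessThan_Suc inj_on_def)
  show "q(t := v) ` {..<Suc t} = insert v (q ` {..<t})"
    unfolding lessThan_Suc image_insert * by simp
qed

lemma runs_queue_loop: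
  assumes "s ''n'' 0 = n" "s ''i'' 0 = 0" "s ''t'' 0 = 0"
  shows "runs queue_loop s (\<lambda>t s'. t \<le> n * 40 + 40 \<and>
    (inj_on (s' ''q'') {..<s' ''t'' 0} \<and>
     s' ''q'' ` {..<s' ''t'' 0} = {v. v < n \<and> s ''deg'' v < 2}) \<and>
    (\<forall>a. a \<notin> {''i'', ''t'', ''q''} \<longrightarrow> s' a = s a))"
  unfolding queue_loop_def
  apply (rule runs_mono)
   apply (rule runs_While[where N = n and B = 25 and T = "n * 40 + 40" and
        I = "\<lambda>m s'. s' ''i'' 0 = m \<and> inj_on (s' ''q'') {..<s' ''t'' 0} \<and>
          s' ''q'' ` {..<s' ''t'' 0} = {v. v < m \<and> s ''deg'' v < 2}"])
  subgoal using assms by simp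
  subgoal for m s'
    using inj_on_push[of "s' ''q''" "s' ''t'' 0" m] assms
    by (auto simp: runs_simps less_Suc_eq)
  subgoal using assms by simp
  subgoal by simp
  subgoal by auto
  done

text \<open>Testing for degree exactly 1 queues every vertex once: a drop to 0 means that
  \<open>y\<close> had degree 1 and is in the queue already. After \<open>x\<close> has been peeled,
  \<open>ns\<close> at \<open>x\<close> is not touched again and so keeps the parent of
  \<open>x\<close>. The loop stops with one vertex left, the root.\<close>

definition peel_loop :: com where
  "peel_loop = While (Less (Plus (var ''i'') (Const 1)) (var ''n''))
    (assign ''x'' (Read ''q'' (var ''i'')) ;;
     assign ''y'' (Read ''ns'' (var ''x'')) ;;
     Write ''deg'' (var ''y'') (Minus (Read ''deg'' (var ''y'')) (Const 1)) ;;
     Write ''ns'' (var ''y'') (Minus (Read ''ns'' (var ''y'')) (var ''x'')) ;;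
     Cond (Eq (Read ''deg'' (var ''y'')) (Const 1))
       (Write ''q'' (var ''t'') (var ''y'') ;; incr ''t'') Skip ;;
     incr ''i'')"

text \<open>After \<open>m\<close> vertices have been peeled off, the queue cells \<open>m, \<dots>, t - 1\<close> contain
  the vertices of degree at most one in the remaining graph.\<close>

definition peeled :: "nat \<Rightarrow> (nat \<times> nat) set \<Rightarrow> (nat \<Rightarrow> nat) \<Rightarrow> nat \<Rightarrow> (nat \<Rightarrow> nat) \<Rightarrow> (nat \<Rightarrow> nat) \<Rightarrow> nat \<Rightarrow> bool" where
  "peeled n E q t deg ns m \<longleftrightarrow> inj_on q {..<t} \<and> q ` {..<t} \<subseteq> {..<n} \<and> m \<le> t \<and> m < n \<and>
    (let R = {..<n} - q ` {..<m} in cut_connected E R \<and>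
      q ` {m..<t} = {x \<in> R. card (nbrs E R x) \<le> 1} \<and>
      (\<forall>x\<in>R. deg x = card (nbrs E R x) \<and> ns x = \<Sum>(nbrs E R x))) \<and>
    (\<forall>i<m. nbrs E ({..<n} - q ` {..<i}) (q i) = {ns (q i)})"

text \<open>Acyclicity enters the peeling argument only as \<open>leaf\<close>: every nonempty
  induced subgraph has a vertex of degree at most one.\<close>

locale leafy_graph =
  fixes n :: nat and E :: "(nat \<times> nat) set"
  assumes sym: "sym E" and irrefl: "(x, x) \<notin> E" and E_subset: "E \<subseteq> {..<n} \<times> {..<n}"
    and leaf: "R \<subseteq> {..<n} \<Longrightarrow> R \<noteq> {} \<Longrightarrow> \<exists>x\<in>R. card (nbrs E R x) \<le> 1"
begin

text \<open>\<open>leaf\<close> keeps the queue from running dry. While at least two vertices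
  remain, connectivity excludes degree 0, so a queued vertex has exactly one neighbour, and the sum
  over its neighbours is that neighbour.\<close>

lemma peeled_next:
  assumes P: "peeled n E q t deg ns m"
  shows "m < t" "q m \<in> {..<n} - q ` {..<m}"
    "Suc m < n \<Longrightarrow> nbrs E ({..<n} - q ` {..<m}) (q m) = {ns (q m)}"
    "Suc m < n \<Longrightarrow> ns (q m) \<in> {..<n} - q ` {..<m}" "Suc m < n \<Longrightarrow> ns (q m) \<noteq> q m"
proof -
  let ?R = "{..<n} - q ` {..<m}"
  note p = P[unfolded peeled_def Let_def]
  have inj: "inj_on q {..<m}" using p by (auto intro: inj_on_subset)
  have sub: "q ` {..<m} \<subseteq> {..<n}" using p image_mono[of "{..<m}" "{..<t}" q] by auto
  have card: "card ?R = n - m"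
    using card_Diff_subset[of "q ` {..<m}" "{..<n}"] sub inj by (simp add: card_image)
  have "?R \<noteq> {}" using p card by (metis card.empty zero_less_diff less_irrefl)
  then have "\<exists>x\<in>?R. card (nbrs E ?R x) \<le> 1" by (intro leaf) auto
  then have "q ` {m..<t} \<noteq> {}" using p by auto
  then show mt: "m < t" by auto
  then have "q m \<in> q ` {m..<t}" by auto
  then have qm: "q m \<in> ?R" "card (nbrs E ?R (q m)) \<le> 1" using p by auto
  then show "q m \<in> ?R" by simp
  assume m: "Suc m < n"
  have "?R \<noteq> {q m}"
  proof
    assume "?R = {q m}"
    then have "card ?R = 1" by simp
    then show False using card m by simp
  qed
  moreover have "cut_connected E ?R" using p by blast
  ultimately have "nbrs E ?R (q m) \<noteq> {}" using nbrs_nonempty[OF _ qm(1)] by blast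
  then have "card (nbrs E ?R (q m)) \<noteq> 0" by simp
  then have "card (nbrs E ?R (q m)) = 1" using qm(2) by linarith
  then obtain y where y: "nbrs E ?R (q m) = {y}" by (auto simp: card_1_singleton_iff)
  moreover have "ns (q m) = \<Sum>(nbrs E ?R (q m))" using p qm(1) by blast
  ultimately show nb: "nbrs E ?R (q m) = {ns (q m)}" by simp
  then have "ns (q m) \<in> ?R \<and> (q m, ns (q m)) \<in> E" by (auto simp: nbrs_def)
  then show "ns (q m) \<in> ?R" "ns (q m) \<noteq> q m" using irrefl by metis+
qed

text \<open>Among the remaining vertices, removing \<open>q m\<close> affects the neighbourhood of
  \<open>y\<close> alone. As \<open>y\<close> itself remains, the parents recorded in
  \<open>ns\<close> for the vertices peeled so far survive the update.\<close>

lemma peeled_step: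
  assumes P: "peeled n E q t deg ns m" and m: "Suc m < n"
  defines "y \<equiv> ns (q m)"
  defines "deg' \<equiv> deg(y := deg y - 1)"
  shows "peeled n E (if deg' y = 1 then q(t := y) else q) (if deg' y = 1 then Suc t else t)
    deg' (ns(y := ns y - q m)) (Suc m)" (is "peeled n E ?q ?t deg' ?ns _")
proof -
  let ?R = "{..<n} - q ` {..<m}" and ?R' = "{..<n} - q ` {..<Suc m}"
  note p = P[unfolded peeled_def Let_def]
  have mt: "m < t" and x: "q m \<in> ?R" and nb: "nbrs E ?R (q m) = {y}" and y: "y \<in> ?R" "y \<noteq> q m"
    using peeled_next[OF P] m by (auto simp: y_def)
  have R': "?R' = ?R - {q m}" by (auto simp: lessThan_Suc)
  have con: "cut_connected E ?R'" unfolding R'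
    using p nb sym irrefl by (intro cut_connected_remove_leaf) auto
  have fin: "finite (nbrs E ?R z)" for z by simp
  have nbR': "nbrs E ?R' z = nbrs E ?R z - {q m}" for z unfolding R' by (auto simp: nbrs_def)
  have other: "nbrs E ?R' z = nbrs E ?R z" if "z \<in> ?R" "z \<noteq> y" for z
  proof -
    have "(q m, z) \<notin> E" using nb that by (auto simp: nbrs_def)
    then have "(z, q m) \<notin> E" using sym by (auto dest: symD)
    then show ?thesis unfolding nbR' by (auto simp: nbrs_def)
  qed
  have xy: "q m \<in> nbrs E ?R y"
  proof -
    have "(q m, y) \<in> E" using nb by (auto simp: nbrs_def)
    then show ?thesis using sym x by (auto simp: nbrs_def dest: symD)
  qed
  have cy: "card (nbrs E ?R' y) = deg y - 1" "\<Sum>(nbrs E ?R' y) = ns y - q m"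
    using xy fin p y by (auto simp: nbR' sum_diff1_nat)
  have degs: "deg' z = card (nbrs E ?R' z) \<and> ?ns z = \<Sum>(nbrs E ?R' z)" if "z \<in> ?R'" for z
    using that cy other[of z] p R' by (cases "z = y") (auto simp: deg'_def)
  have q': "?q i = q i" if "i < t" for i using that by auto
  have im: "?q ` A = q ` A" if "A \<subseteq> {..<t}" for A using that q' by (intro image_cong) auto
  have queue: "q ` {Suc m..<t} = q ` {m..<t} - {q m}"
  proof -
    have "{m..<t} = insert m {Suc m..<t}" using mt by auto
    moreover have "q m \<notin> q ` {Suc m..<t}"
      using inj_onD[of q "{..<t}" m] p mt by fastforce
    ultimately show ?thesis by auto
  qed
  have old: "q ` {m..<t} = {x \<in> ?R. card (nbrs E ?R x) \<le> 1}" using p by blast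
  have degy: "deg y = card (nbrs E ?R y)" using p y by blast
  have degy0: "deg y \<noteq> 0" using degy xy fin by auto
  have new: "?q ` {Suc m..<?t} = {z \<in> ?R'. card (nbrs E ?R' z) \<le> 1}"
  proof (cases "deg' y = 1")
    case True
    then have d: "deg y = 2" by (simp add: deg'_def)
    have "{Suc m..<?t} = insert t {Suc m..<t}" using True mt by auto
    then have "?q ` {Suc m..<?t} = insert y (q ` {Suc m..<t})"
      using True im[of "{Suc m..<t}"] by auto
    also have "\<dots> = {z \<in> ?R'. card (nbrs E ?R' z) \<le> 1}"
    proof -
      have "z \<in> insert y (q ` {Suc m..<t}) \<longleftrightarrow> z \<in> ?R' \<and> card (nbrs E ?R' z) \<le> 1" for z
        using other[of z] cy y d unfolding queue old R' by (cases "z = y") auto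
      then show ?thesis by blast
    qed
    finally show ?thesis .
  next
    \<comment> \<open>Either \<open>y\<close> keeps degree at least two, or its old degree was 1 and
      it is in the queue already.\<close>
    case False
    then have d: "deg y \<noteq> 2" by (simp add: deg'_def)
    have "z \<in> q ` {Suc m..<t} \<longleftrightarrow> z \<in> ?R' \<and> card (nbrs E ?R' z) \<le> 1" for z
      using other[of z] cy y d degy degy0 unfolding queue old R' by (cases "z = y") auto
    then show ?thesis using False by auto
  qed
  have push: "inj_on ?q {..<?t} \<and> ?q ` {..<?t} \<subseteq> {..<n}"
  proof (cases "deg' y = 1")
    case True
    then have d: "deg y = 2" by (simp add: deg'_def)
    have "{..<t} = {..<m} \<union> {m..<t}" using mt by auto
    moreover have "y \<notin> q ` {m..<t}" using d degy unfolding old by simp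
    ultimately have "y \<notin> q ` {..<t}" using y by (simp add: image_Un)
    then show ?thesis using True inj_on_push[of q t y] p y by auto
  qed (use p in auto)
  have imS: "?q ` {..<i} = q ` {..<i}" if "i \<le> Suc m" for i using that mt by (intro im) auto
  have past: "nbrs E ({..<n} - ?q ` {..<i}) (?q i) = {?ns (?q i)}" if "i < Suc m" for i
  proof (cases "i = m")
    case True
    then show ?thesis using nb y imS[of m] q'[OF mt] by (simp add: y_def)
  next
    case False
    then have i: "i < m" using that by simp
    then have "q i \<noteq> y" using y by auto
    moreover have "nbrs E ({..<n} - q ` {..<i}) (q i) = {ns (q i)}" using p i by blast
    ultimately show ?thesis using imS[of i] q'[of i] i mt by simp
  qed
  have sm: "Suc m \<le> ?t" using mt by auto
  show ?thesis
    unfolding peeled_def Let_def imS[OF order_refl]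
    using push con new degs past m sm by blast
qed

lemma runs_peel_loop:
  assumes "s ''n'' 0 = n" "s ''i'' 0 = 0" "peeled n E (s ''q'') (s ''t'' 0) (s ''deg'') (s ''ns'') 0"
  shows "runs peel_loop s (\<lambda>t s'. t \<le> n * 60 + 60 \<and>
    peeled n E (s' ''q'') (s' ''t'' 0) (s' ''deg'') (s' ''ns'') (n - 1) \<and>
    (\<forall>a. a \<notin> {''i'', ''t'', ''q'', ''x'', ''y'', ''deg'', ''ns''} \<longrightarrow> s' a = s a))"
  unfolding peel_loop_def
  apply (rule runs_mono)
   apply (rule runs_While[where N = "n - 1" and B = 50 and T = "n * 60 + 60" and
        I = "\<lambda>m s'. s' ''i'' 0 = m \<and> peeled n E (s' ''q'') (s' ''t'' 0) (s' ''deg'') (s' ''ns'') m"])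
  subgoal using assms by simp
  subgoal premises prems for m s'
  proof -
    have n: "s' ''n'' 0 = n" using prems(3)[of "''n''"] assms(1) by simp
    have i: "s' ''i'' 0 = m" and P: "peeled n E (s' ''q'') (s' ''t'' 0) (s' ''deg'') (s' ''ns'') m"
      using prems(2) by auto
    have m: "Suc m < n" using prems(1) by simp
    show ?thesis
      using peeled_step[OF P m] m
      by (cases "s' ''deg'' (s' ''ns'' (s' ''q'' m)) - 1 = 1") (simp_all add: runs_simps n i)
  qed
  subgoal using assms by simp
  subgoal by simp
  subgoal by auto
  done

definition parent :: "(nat \<Rightarrow> nat) \<Rightarrow> (nat \<Rightarrow> nat) \<Rightarrow> nat \<Rightarrow> nat" where
  "parent q ns i = the_inv_into {..<n} q (ns (q i))"

text \<open>The queue is complete, since it is injective and reaches beyond position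
  \<open>n - 1\<close>. For an edge between positions \<open>i < j\<close>, the vertex
  \<open>q j\<close> is still present when \<open>q i\<close> is peeled, so it is the only remaining
  neighbour of \<open>q i\<close>, that is, its parent. Hence no edge is missed.\<close>

lemma peeled_final:
  assumes P: "peeled n E q t deg ns (n - 1)"
  shows "bij_betw q {..<n} {..<n}" "increasing_tree n (parent q ns)"
    "Suc i < n \<Longrightarrow> q (parent q ns i) = ns (q i)"
    "E = map_prod q q ` increasing_tree.edges n (parent q ns)"
proof -
  note p = P[unfolded peeled_def Let_def]
  have n: "0 < n" using p by auto
  have "t \<le> n"
    using card_inj_on_le[of q "{..<t}" "{..<n}"] p by simp
  moreover have "n - 1 < t" using peeled_next(1)[OF P] .
  ultimately have t: "t = n" using n by simp
  show bij: "bij_betw q {..<n} {..<n}"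
    using p unfolding t bij_betw_def by (metis card_image card_subset_eq finite_lessThan)
  then have inj: "inj_on q {..<n}" and im: "q ` {..<n} = {..<n}" by (auto simp: bij_betw_def)
  let ?p = "parent q ns"
  have nb: "nbrs E ({..<n} - q ` {..<i}) (q i) = {ns (q i)}" if "Suc i < n" for i
    using p that by auto
  have par: "i < ?p i \<and> ?p i < n \<and> q (?p i) = ns (q i)" if i: "Suc i < n" for i
  proof -
    have y: "ns (q i) < n" "ns (q i) \<notin> q ` {..<i}" "(q i, ns (q i)) \<in> E" using nb[OF i] by (auto simp: nbrs_def)
    then have "ns (q i) \<in> q ` {..<n}" using im by auto
    then have pi: "?p i < n" "q (?p i) = ns (q i)"
      using the_inv_into_into[OF inj, of _ "{..<n}"] f_the_inv_into_f[OF inj] by (auto simp: parent_def)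
    then have "\<not> ?p i < i" using y by force
    moreover have "?p i \<noteq> i" using pi y irrefl by metis
    ultimately show ?thesis using pi by auto
  qed
  show tree: "increasing_tree n ?p" using n par by unfold_locales auto
  show "Suc i < n \<Longrightarrow> q (?p i) = ns (q i)" using par by blast
  interpret increasing_tree n ?p by (rule tree)
  have in1: "(q i, ns (q i)) \<in> E" if "Suc i < n" for i using nb[OF that] by (auto simp: nbrs_def)
  show "E = map_prod q q ` edges"
  proof
    show "map_prod q q ` edges \<subseteq> E"
    proof
      fix e assume "e \<in> map_prod q q ` edges"
      then obtain i where "Suc i < n" "e = (q i, q (?p i)) \<or> e = (q (?p i), q i)" by (auto simp: edges_def)
      then show "e \<in> E" using in1[of i] par[of i] sym by (auto dest: symD)
    qed
    have main: "(i, j) \<in> edges" if ij: "(q i, q j) \<in> E" "i < n" "j < n" "i < j" for i j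
    proof -
      have "q j \<notin> q ` {..<i}" using inj_onD[OF inj, of j] ij by fastforce
      then have "q j \<in> nbrs E ({..<n} - q ` {..<i}) (q i)" using ij im by (auto simp: nbrs_def)
      then have "q j = q (?p i)" using nb[of i] par[of i] ij by auto
      then have "j = ?p i" using inj par[of i] ij by (auto simp: inj_on_def)
      then show ?thesis using ij by (auto simp: edges_def)
    qed
    show "E \<subseteq> map_prod q q ` edges"
    proof
      fix e assume e: "e \<in> E"
      obtain u v where uv: "e = (u, v)" by (cases e)
      then have "u \<in> q ` {..<n}" "v \<in> q ` {..<n}" using e E_subset im by auto
      then obtain i j where ij: "u = q i" "v = q j" "i < n" "j < n" by auto
      have "i \<noteq> j" using ij uv e irrefl by auto
      then consider "i < j" | "j < i" by linarith
      then have "(i, j) \<in> edges"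
      proof cases
        case 1
        then show ?thesis using main ij uv e by auto
      next
        case 2
        have "(q j, q i) \<in> E" using e uv ij sym by (auto dest: symD)
        then have "(j, i) \<in> edges" using main 2 ij by auto
        then show ?thesis by (auto simp: edges_def)
      qed
      then show "e \<in> map_prod q q ` edges" using uv ij by force
    qed
  qed
qed

end

section \<open>The knapsack phase\<close>

text \<open>Row addresses are obtained by repeated addition, as the machine has no multiplication.
  The bound \<open>W\<close> enters the program only here, as it determines the width of a table
  row.\<close>

definition relabel_loop :: com where
  "relabel_loop = While (Less (var ''i'') (var ''n''))
    (Write ''pos'' (Read ''q'' (var ''i'')) (var ''i'') ;;
     Write ''a'' (var ''i'') (Read ''wm'' (Read ''q'' (var ''i''))) ;;
     Write ''sb'' (var ''i'') (Read ''wp'' (Read ''q'' (var ''i''))) ;;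
     Write ''base'' (Plus (var ''i'') (Const 1)) (Plus (Read ''base'' (var ''i'')) (Plus (var ''W'') (Const 1))) ;;
     incr ''i'')"

lemma runs_relabel_loop:
  assumes "s ''n'' 0 = n" "s ''W'' 0 = W" "s ''i'' 0 = 0" "s ''base'' 0 = 0" "inj_on (s ''q'') {..<n}"
  shows "runs relabel_loop s (\<lambda>t s'. t \<le> n * 60 + 60 \<and>
    (\<forall>i<n. s' ''pos'' (s ''q'' i) = i \<and> s' ''a'' i = s ''wm'' (s ''q'' i) \<and>
       s' ''sb'' i = s ''wp'' (s ''q'' i) \<and> s' ''base'' i = i * (W + 1)) \<and>
    (\<forall>a. a \<notin> {''i'', ''pos'', ''a'', ''sb'', ''base''} \<longrightarrow> s' a = s a))"
  unfolding relabel_loop_def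
  apply (rule runs_mono)
   apply (rule runs_While[where N = n and B = 50 and T = "n * 60 + 60" and
        I = "\<lambda>m s'. s' ''i'' 0 = m \<and> (\<forall>i<m. s' ''pos'' (s ''q'' i) = i \<and> s' ''a'' i = s ''wm'' (s ''q'' i) \<and>
       s' ''sb'' i = s ''wp'' (s ''q'' i)) \<and> (\<forall>i\<le>m. s' ''base'' i = i * (W + 1))"])
  subgoal using assms by simp
  subgoal premises prems for m s'
  proof -
    have fr: "s' ''n'' = s ''n''" "s' ''W'' = s ''W''" "s' ''q'' = s ''q''" "s' ''wm'' = s ''wm''"
      "s' ''wp'' = s ''wp''"
      using prems(3) by simp_all
    have "s ''q'' i \<noteq> s ''q'' m" if "i < m" for i
      using inj_onD[OF assms(5), of i m] that prems(1) by auto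
    then show ?thesis using prems(1,2) assms(1,2) by (auto simp: runs_simps fr less_Suc_eq le_Suc_eq)
  qed
  subgoal using assms by simp
  subgoal by simp
  subgoal by auto
  done

text \<open>Children precede parents, so \<open>sb\<close> at \<open>i\<close> is already the weight
  of the full subtree when it is added to the entry of the parent.\<close>

definition parent_loop :: com where
  "parent_loop = While (Less (Plus (var ''i'') (Const 1)) (var ''n''))
    (Write ''par'' (var ''i'') (Read ''pos'' (Read ''ns'' (Read ''q'' (var ''i'')))) ;;
     Write ''sb'' (Read ''par'' (var ''i''))
       (Plus (Read ''sb'' (Read ''par'' (var ''i''))) (Read ''sb'' (var ''i''))) ;;
     incr ''i'')"

text \<open>Zeros are written explicitly because the table still holds the entries for the previous
  \<open>k\<close>. A vertex weight above \<open>k\<close> simply matches no column.\<close>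

definition init_row :: com where
  "init_row = While (Less (var ''j'') (Plus (var ''k'') (Const 1)))
    (Cond (Eq (Read ''a'' (var ''i'')) (var ''j''))
       (Write ''A'' (Plus (Read ''base'' (var ''i'')) (var ''j'')) (Const 1))
       (Write ''A'' (Plus (Read ''base'' (var ''i'')) (var ''j'')) (Const 0)) ;;
     incr ''j'')"

definition init_loop :: com where
  "init_loop = While (Less (var ''i'') (var ''n''))
    (assign ''j'' (Const 0) ;; init_row ;; incr ''i'')"

text \<open>A later successful \<open>l\<close> overwrites earlier choices, including the one to
  leave the child out; any of them would do.\<close>

definition choice_loop :: com where
  "choice_loop = While (Less (var ''l'') (Plus (var ''j'') (Const 1)))
    (Cond (Conj
        (Neg (Eq (Read ''A'' (Plus (Read ''base'' (var ''u'')) (Minus (var ''j'') (var ''l'')))) (Const 0)))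
        (Neg (Eq (Read ''A'' (Plus (Read ''base'' (var ''i'')) (var ''l''))) (Const 0))))
       (assign ''c'' (Plus (var ''l'') (Const 2))) Skip ;;
     incr ''l'')"

text \<open>The table of the parent is updated in place; this is sound because \<open>j\<close> decreases and only
  cells with smaller or equal index are read. The entry \<open>0\<close> of \<open>ch\<close> stands for no solution,
  \<open>1\<close> for leaving the child out, and \<open>l + 2\<close> for giving weight \<open>l\<close> to it.\<close>

definition row_loop :: com where
  "row_loop = While (Less (Const 0) (var ''j''))
    (assign ''j'' (Minus (var ''j'') (Const 1)) ;;
     assign ''c'' (Const 0) ;;
     Cond (Conj (Neg (Eq (Read ''A'' (Plus (Read ''base'' (var ''u'')) (var ''j''))) (Const 0)))
         (Less (Read ''sb'' (var ''i'')) (Plus (var ''k'') (Const 1))))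
       (assign ''c'' (Const 1)) Skip ;;
     assign ''l'' (Const 0) ;;
     choice_loop ;;
     Write ''ch'' (Plus (Read ''base'' (var ''i'')) (var ''j'')) (var ''c'') ;;
     Write ''A'' (Plus (Read ''base'' (var ''u'')) (var ''j'')) (var ''c''))"

definition merge_loop :: com where
  "merge_loop = While (Less (Plus (var ''i'') (Const 1)) (var ''n''))
    (assign ''u'' (Read ''par'' (var ''i'')) ;;
     assign ''j'' (Plus (var ''k'') (Const 1)) ;;
     row_loop ;;
     incr ''i'')"

definition check_loop :: com where
  "check_loop = While (Less (var ''i'') (var ''n''))
    (Cond (Conj (Less (Minus (var ''tot'') (Read ''sb'' (var ''i''))) (Plus (var ''k'') (Const 1)))
        (Neg (Eq (Read ''A'' (Plus (Read ''base'' (var ''i'')) (var ''k''))) (Const 0))))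
       (assign ''f'' (Const 1) ;; assign ''top'' (var ''i'')) Skip ;;
     incr ''i'')"

text \<open>There is no test against \<open>W\<close>: the promised safe set guarantees a success at
  some \<open>k \<le> W\<close>. As \<open>k\<close> is increased only after a failure, it holds the
  optimum on exit.\<close>

definition search_loop :: com where
  "search_loop = While (Eq (var ''f'') (Const 0))
    (assign ''i'' (Const 0) ;; init_loop ;;
     assign ''i'' (Const 0) ;; merge_loop ;;
     assign ''i'' (Const 0) ;; check_loop ;;
     Cond (Eq (var ''f'') (Const 0)) (incr ''k'') Skip)"

text \<open>Merges are undone in reverse order, so \<open>cur\<close> at \<open>u\<close> is the
  weight required of \<open>u\<close> just after the merge of \<open>i\<close>. Choices are stored
  in the row of the child, which is merged only once per \<open>k\<close>, so those for the final
  \<open>k\<close> are all intact.\<close>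

definition trace_loop :: com where
  "trace_loop = While (Less (Const 0) (var ''i''))
    (assign ''i'' (Minus (var ''i'') (Const 1)) ;;
     assign ''u'' (Read ''par'' (var ''i'')) ;;
     Cond (Eq (Read ''sel'' (var ''u'')) (Const 0)) Skip
       (assign ''c'' (Read ''ch'' (Plus (Read ''base'' (var ''i'')) (Read ''cur'' (var ''u'')))) ;;
        Cond (Less (Const 1) (var ''c''))
          (Write ''sel'' (var ''i'') (Const 1) ;;
           Write ''cur'' (var ''i'') (Minus (var ''c'') (Const 2)) ;;
           Write ''cur'' (var ''u'') (Minus (Read ''cur'' (var ''u'')) (Minus (var ''c'') (Const 2))))
          Skip))"

definition output_loop :: com where
  "output_loop = While (Less (var ''i'') (var ''n''))
    (Write ''out'' (Read ''q'' (var ''i'')) (Read ''sel'' (var ''i'')) ;; incr ''i'')"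

lemma writes_loops [simp]:
  "writes init_row = {''A'', ''j''}"
  "writes init_loop = {''A'', ''j'', ''i''}"
  "writes choice_loop = {''c'', ''l''}"
  "writes row_loop = {''j'', ''c'', ''l'', ''ch'', ''A''}"
  "writes merge_loop = {''u'', ''j'', ''c'', ''l'', ''ch'', ''A'', ''i''}"
  "writes check_loop = {''f'', ''top'', ''i''}"
  by (auto simp: init_row_def init_loop_def choice_loop_def row_loop_def merge_loop_def check_loop_def)

definition cell :: "nat \<Rightarrow> nat \<Rightarrow> nat \<Rightarrow> nat" where
  "cell W i j = i * (W + 1) + j"

lemma cell_eq_iff:
  assumes "j \<le> W" "j' \<le> W"
  shows "cell W i j = cell W i' j' \<longleftrightarrow> i = i' \<and> j = j'"
proof
  assume eq: "cell W i j = cell W i' j'"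
  have "cell W i j div (W + 1) = i" "cell W i' j' div (W + 1) = i'"
    using assms unfolding cell_def by (simp_all del: add_Suc_right mult_Suc_right add: div_mult_self3)
  then show "i = i' \<and> j = j'" using eq by (auto simp: cell_def)
qed simp

section \<open>Correctness and running time of the loops on a fixed rooted tree\<close>

context increasing_tree
begin

text \<open>The partial sums are the weights of the blocks \<open>below m v\<close>, which grow from
  single vertices to full subtrees.\<close>

lemma runs_parent_loop:
  assumes "s ''n'' 0 = n" "s ''i'' 0 = 0"
    and "\<And>i. Suc i < n \<Longrightarrow> s ''pos'' (s ''ns'' (s ''q'' i)) = p i" "\<And>i. i < n \<Longrightarrow> s ''sb'' i = b i"
  shows "runs parent_loop s (\<lambda>t s'. t \<le> n * 60 + 60 \<and>
    ((\<forall>i. Suc i < n \<longrightarrow> s' ''par'' i = p i) \<and> (\<forall>v<n. s' ''sb'' v = sum b (subtree v))) \<and>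
    (\<forall>a. a \<notin> {''i'', ''par'', ''sb''} \<longrightarrow> s' a = s a))"
  unfolding parent_loop_def
  apply (rule runs_mono)
   apply (rule runs_While[where N = "n - 1" and B = 50 and T = "n * 60 + 60" and
        I = "\<lambda>m s'. s' ''i'' 0 = m \<and> (\<forall>i<m. s' ''par'' i = p i) \<and> (\<forall>v<n. s' ''sb'' v = sum b (below m v))"])
  subgoal using assms by (simp add: below_0)
  subgoal premises prems for m s'
  proof -
    have fr: "s' ''n'' = s ''n''" "s' ''q'' = s ''q''" "s' ''ns'' = s ''ns''" "s' ''pos'' = s ''pos''"
      using prems(3) by simp_all
    have m: "Suc m < n" using prems(1) by simp
    have i: "s' ''i'' 0 = m" and par: "\<And>i. i < m \<Longrightarrow> s' ''par'' i = p i"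
      and sb: "\<And>v. v < n \<Longrightarrow> s' ''sb'' v = sum b (below m v)"
      using prems(2) by auto
    show ?thesis using m parent_less[OF m]
      by (auto simp: runs_simps fr less_Suc_eq i par sb assms(1,3) sum_below_Suc[OF m])
  qed
  subgoal using assms by simp
  subgoal by simp
  subgoal using pos by auto
  done

text \<open>The data that the search and the traceback only read.\<close>

definition ready :: "(nat \<Rightarrow> nat) \<Rightarrow> (nat \<Rightarrow> nat) \<Rightarrow> nat \<Rightarrow> state \<Rightarrow> bool" where
  "ready a b W s \<longleftrightarrow> s ''n'' 0 = n \<and> s ''tot'' 0 = sum b {..<n} \<and> (\<forall>i. Suc i < n \<longrightarrow> s ''par'' i = p i) \<and>
    (\<forall>i<n. s ''a'' i = a i \<and> s ''sb'' i = sum b (subtree i) \<and> s ''base'' i = i * (W + 1))"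

lemma ready_frame:
  "ready a b W s \<Longrightarrow> s' ''n'' = s ''n'' \<Longrightarrow> s' ''tot'' = s ''tot'' \<Longrightarrow> s' ''par'' = s ''par'' \<Longrightarrow>
    s' ''a'' = s ''a'' \<Longrightarrow> s' ''sb'' = s ''sb'' \<Longrightarrow> s' ''base'' = s ''base'' \<Longrightarrow> ready a b W s'"
  by (simp add: ready_def)

lemma runs_init_row:
  assumes R: "ready a b W s" and "s ''k'' 0 = k" "k \<le> W" "s ''i'' 0 = i" "i < n" "s ''j'' 0 = 0"
  shows "runs init_row s (\<lambda>t s'. t \<le> (k + 1) * 40 + 20 \<and>
    (\<forall>v j. j \<le> W \<longrightarrow> s' ''A'' (cell W v j) =
        (if v = i \<and> j \<le> k then (if j = a i then 1 else 0) else s ''A'' (cell W v j))) \<and>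
    (\<forall>x. x \<notin> {''A'', ''j''} \<longrightarrow> s' x = s x))"
  unfolding init_row_def
  apply (rule runs_mono)
   apply (rule runs_While[where N = "k + 1" and B = 30 and T = "(k + 1) * 40 + 20" and
        I = "\<lambda>m s'. s' ''j'' 0 = m \<and> (\<forall>v j. j \<le> W \<longrightarrow> s' ''A'' (cell W v j) =
        (if v = i \<and> j < m then (if j = a i then 1 else 0) else s ''A'' (cell W v j)))"])
  subgoal using assms by simp
  subgoal premises prems for m s'
  proof -
    have fr: "s' ''k'' = s ''k''" "s' ''i'' = s ''i''" "s' ''a'' = s ''a''" "s' ''base'' = s ''base''"
      using prems(3) by simp_all
    have rd: "s ''a'' i = a i" "\<And>x. s ''base'' i + x = cell W i x"
      using R assms(5) by (auto simp: ready_def cell_def)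
    have m: "m \<le> W" "m \<le> k" using prems(1) assms(3) by simp_all
    have j: "s' ''j'' 0 = m" and A: "\<And>v j. j \<le> W \<Longrightarrow> s' ''A'' (cell W v j) =
        (if v = i \<and> j < m then (if j = a i then 1 else 0) else s ''A'' (cell W v j))"
      using prems(2) by auto
    show ?thesis
      using m by (cases "a i = m")
        (simp_all add: runs_simps fr rd cell_eq_iff j assms(2,4) split del: if_split,
         auto simp: A less_Suc_eq)
  qed
  subgoal using assms by simp
  subgoal by simp
  subgoal by (auto simp: less_Suc_eq_le)
  done

lemma runs_init_loop:
  assumes R: "ready a b W s" and "s ''k'' 0 = k" "k \<le> W" "s ''i'' 0 = 0"
  shows "runs init_loop s (\<lambda>t s'. t \<le> n * ((k + 1) * 40 + 60) + 20 \<and>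
    (\<forall>v<n. \<forall>j\<le>k. s' ''A'' (cell W v j) \<noteq> 0 \<longleftrightarrow> attainable a b k 0 v j) \<and>
    (\<forall>x. x \<notin> {''A'', ''j'', ''i''} \<longrightarrow> s' x = s x))"
  unfolding init_loop_def
  apply (rule runs_mono)
   apply (rule runs_While[where N = n and B = "(k + 1) * 40 + 50" and T = "n * ((k + 1) * 40 + 60) + 20" and
        I = "\<lambda>m s'. s' ''i'' 0 = m \<and> (\<forall>v<m. \<forall>j\<le>k. s' ''A'' (cell W v j) \<noteq> 0 \<longleftrightarrow> attainable a b k 0 v j)"])
  subgoal using assms by simp
  subgoal premises prems for m s'
  proof -
    let ?s = "s'(''j'' := (s' ''j'')(0 := 0))"
    have fr: "s' ''k'' = s ''k''" "s' ''n'' = s ''n''" using prems(3) by simp_all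
    have "s ''n'' 0 = n" using R by (simp add: ready_def)
    moreover have rd: "ready a b W ?s" by (rule ready_frame[OF R]) (simp_all add: prems(3))
    then have "runs init_row ?s (\<lambda>t s''. t \<le> (k + 1) * 40 + 20 \<and>
      (\<forall>v j. j \<le> W \<longrightarrow> s'' ''A'' (cell W v j) =
        (if v = m \<and> j \<le> k then (if j = a m then 1 else 0) else ?s ''A'' (cell W v j))) \<and>
      (\<forall>x. x \<notin> {''A'', ''j''} \<longrightarrow> s'' x = ?s x))"
      using prems(1,2) assms fr by (intro runs_init_row[OF rd]) auto
    then have "runs (assign ''j'' (Const 0) ;; init_row ;; incr ''i'') s'
      (\<lambda>t s''. t \<le> (k + 1) * 40 + 50 \<and> s'' ''i'' 0 = Suc m \<and>
        (\<forall>v<Suc m. \<forall>j\<le>k. s'' ''A'' (cell W v j) \<noteq> 0 \<longleftrightarrow> attainable a b k 0 v j))"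
      unfolding runs_Seq runs_Write[of "''j''"] aval.simps
      by (rule runs_mono) (use prems(2) assms(3) in \<open>auto simp: runs_simps less_Suc_eq\<close>)
    ultimately show ?thesis using prems(1,2) fr by simp
  qed
  subgoal using R by (simp add: ready_def)
  subgoal by (simp add: algebra_simps)
  subgoal by auto
  done

text \<open>A relation and not a function, since the traceback works with any valid choice;
  \<open>m\<close> counts the values of \<open>l\<close> tried so far.\<close>

definition choice_upto :: "(nat \<Rightarrow> nat) \<Rightarrow> (nat \<Rightarrow> nat) \<Rightarrow> nat \<Rightarrow> nat \<Rightarrow> nat \<Rightarrow> nat \<Rightarrow> nat \<Rightarrow> bool" where
  "choice_upto a b k h j m c \<longleftrightarrow>
    (c = 0 \<longleftrightarrow> \<not> (attainable a b k h (p h) j \<and> sum b (subtree h) \<le> k) \<and>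
       \<not> (\<exists>l<m. attainable a b k h (p h) (j - l) \<and> attainable a b k h h l)) \<and>
    (c = 1 \<longrightarrow> attainable a b k h (p h) j \<and> sum b (subtree h) \<le> k) \<and>
    (1 < c \<longrightarrow> c - 2 < m \<and> attainable a b k h (p h) (j - (c - 2)) \<and> attainable a b k h h (c - 2))"

definition choice :: "(nat \<Rightarrow> nat) \<Rightarrow> (nat \<Rightarrow> nat) \<Rightarrow> nat \<Rightarrow> nat \<Rightarrow> nat \<Rightarrow> nat \<Rightarrow> bool" where
  "choice a b k h j c \<longleftrightarrow> choice_upto a b k h j (Suc j) c"

lemma choice_upto_0:
  "choice_upto a b k h j 0 (if attainable a b k h (p h) j \<and> sum b (subtree h) \<le> k then 1 else 0)"
  by (simp add: choice_upto_def)

lemma choice_upto_Suc: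
  assumes "choice_upto a b k h j m c"
  shows "choice_upto a b k h j (Suc m)
    (if attainable a b k h (p h) (j - m) \<and> attainable a b k h h m then m + 2 else c)"
  using assms by (auto simp: choice_upto_def less_Suc_eq)

lemma choice_nonzero_iff: "choice a b k h j c \<Longrightarrow> c \<noteq> 0 \<longleftrightarrow> attainable a b k (Suc h) (p h) j"
  by (auto simp: choice_def choice_upto_def less_Suc_eq_le)

text \<open>Hypothesis \<open>A\<close> speaks only of the columns up to \<open>j\<close>, because
  the larger columns in the row of the parent already hold the next level.\<close>

lemma runs_choice_loop:
  assumes R: "ready a b W s" and h: "Suc h < n" and "j \<le> W"
    and s: "s ''i'' 0 = h" "s ''u'' 0 = p h" "s ''j'' 0 = j" "s ''l'' 0 = 0"
    and c: "choice_upto a b k h j 0 (s ''c'' 0)"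
    and A: "\<And>v l. v < n \<Longrightarrow> l \<le> j \<Longrightarrow> s ''A'' (cell W v l) \<noteq> 0 \<longleftrightarrow> attainable a b k h v l"
  shows "runs choice_loop s (\<lambda>t s'. t \<le> (j + 1) * 60 + 20 \<and> choice a b k h j (s' ''c'' 0) \<and>
    (\<forall>x. x \<notin> {''c'', ''l''} \<longrightarrow> s' x = s x))"
  unfolding choice_loop_def
  apply (rule runs_mono)
   apply (rule runs_While[where N = "j + 1" and B = 45 and T = "(j + 1) * 60 + 20" and
        I = "\<lambda>m s'. s' ''l'' 0 = m \<and> choice_upto a b k h j m (s' ''c'' 0)"])
  subgoal using s c by simp
  subgoal premises prems for m s'
  proof -
    have fr: "s' ''i'' = s ''i''" "s' ''u'' = s ''u''" "s' ''j'' = s ''j''" "s' ''A'' = s ''A''"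
      "s' ''base'' = s ''base''"
      using prems(3) by simp_all
    have m: "m \<le> j" using prems(1) by simp
    have rd: "\<And>x. s ''base'' (p h) + x = cell W (p h) x" "\<And>x. s ''base'' h + x = cell W h x"
      using R h parent_less[OF h] by (auto simp: ready_def cell_def)
    have A1: "s ''A'' (cell W (p h) (j - m)) = 0 \<longleftrightarrow> \<not> attainable a b k h (p h) (j - m)"
      "s ''A'' (cell W h m) = 0 \<longleftrightarrow> \<not> attainable a b k h h m"
      using A[of "p h" "j - m"] A[of h m] h parent_less[OF h] m by auto
    have l: "s' ''l'' 0 = m" and c': "choice_upto a b k h j m (s' ''c'' 0)" using prems(2) by auto
    show ?thesis using m choice_upto_Suc[OF c']
      by (cases "attainable a b k h (p h) (j - m) \<and> attainable a b k h h m")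
        (auto simp: runs_simps fr rd s l A1)
  qed
  subgoal using s by simp
  subgoal by simp
  subgoal by (auto simp: choice_def)
  done

definition tabulated :: "(nat \<Rightarrow> nat) \<Rightarrow> (nat \<Rightarrow> nat) \<Rightarrow> nat \<Rightarrow> nat \<Rightarrow> nat \<Rightarrow> (nat \<Rightarrow> nat) \<Rightarrow> bool" where
  "tabulated a b W k h f \<longleftrightarrow> (\<forall>v<n. \<forall>j\<le>k. f (cell W v j) \<noteq> 0 \<longleftrightarrow> attainable a b k h v j)"

definition choices :: "(nat \<Rightarrow> nat) \<Rightarrow> (nat \<Rightarrow> nat) \<Rightarrow> nat \<Rightarrow> nat \<Rightarrow> nat \<Rightarrow> (nat \<Rightarrow> nat) \<Rightarrow> bool" where
  "choices a b W k h f \<longleftrightarrow> (\<forall>i<h. \<forall>j\<le>k. choice a b k i j (f (cell W i j)))"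

lemma runs_row_loop:
  assumes R: "ready a b W s" and h: "Suc h < n" and k: "k \<le> W"
    and s: "s ''i'' 0 = h" "s ''u'' 0 = p h" "s ''j'' 0 = k + 1" "s ''k'' 0 = k"
    and A: "tabulated a b W k h (s ''A'')" and ch: "choices a b W k h (s ''ch'')"
  shows "runs row_loop s (\<lambda>t s'. t \<le> (k + 1) * ((k + 1) * 60 + 100) + 20 \<and>
    (tabulated a b W k (Suc h) (s' ''A'') \<and> choices a b W k (Suc h) (s' ''ch'')) \<and>
    (\<forall>x. x \<notin> {''j'', ''c'', ''l'', ''ch'', ''A''} \<longrightarrow> s' x = s x))"
  unfolding row_loop_def
  apply (rule runs_mono)
   \<comment> \<open>Rows other than that of \<open>p h\<close> do not distinguish the levels
     \<open>h\<close> and \<open>Suc h\<close>, so the invariant raises the level in that row alone,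
     one column after the other from the right.\<close>
   apply (rule runs_While[where N = "k + 1" and B = "(k + 1) * 60 + 90" and
        T = "(k + 1) * ((k + 1) * 60 + 100) + 20" and
        I = "\<lambda>m s'. s' ''j'' 0 = k + 1 - m \<and>
          (\<forall>v<n. \<forall>j\<le>k. s' ''A'' (cell W v j) \<noteq> 0 \<longleftrightarrow>
            attainable a b k (if v = p h \<and> k + 1 - m \<le> j then Suc h else h) v j) \<and>
          (\<forall>i\<le>h. \<forall>j\<le>k. i < h \<or> k + 1 - m \<le> j \<longrightarrow> choice a b k i j (s' ''ch'' (cell W i j)))"])
  subgoal using s A ch by (auto simp: tabulated_def choices_def simp del: attainable.simps)
  subgoal premises prems for m s'
  proof -
    define j where "j = k - m"
    have j: "k + 1 - m = Suc j" "k + 1 - Suc m = j" "j \<le> k" "j \<le> W" "Suc k - m = Suc j"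
      using prems(1) k by (auto simp: j_def)
    have fr: "s' ''i'' = s ''i''" "s' ''u'' = s ''u''" "s' ''k'' = s ''k''"
      "s' ''base'' = s ''base''" "s' ''sb'' = s ''sb''"
      using prems(3) by simp_all
    have sj: "s' ''j'' 0 = Suc j" and A': "\<And>v l. v < n \<Longrightarrow> l \<le> k \<Longrightarrow> s' ''A'' (cell W v l) \<noteq> 0 \<longleftrightarrow>
            attainable a b k (if v = p h \<and> Suc j \<le> l then Suc h else h) v l"
      and ch': "\<And>i l. i \<le> h \<Longrightarrow> l \<le> k \<Longrightarrow> i < h \<or> Suc j \<le> l \<Longrightarrow> choice a b k i l (s' ''ch'' (cell W i l))"
      using prems(2) unfolding j by auto
    have rd: "\<And>x. s ''base'' (p h) + x = cell W (p h) x" "\<And>x. s ''base'' h + x = cell W h x"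
      "s ''sb'' h = sum b (subtree h)"
      using R h parent_less[OF h] by (auto simp: ready_def cell_def)
    have Aj: "s' ''A'' (cell W v l) \<noteq> 0 \<longleftrightarrow> attainable a b k h v l" if "v < n" "l \<le> j" for v l
      using A'[of v l] that j by simp
    define c0 :: nat where "c0 = (if attainable a b k h (p h) j \<and> sum b (subtree h) \<le> k then 1 else 0)"
    let ?s = "s'(''j'' := (s' ''j'')(0 := j), ''c'' := (s' ''c'')(0 := c0), ''l'' := (s' ''l'')(0 := 0))"
    have rs: "ready a b W ?s" by (rule ready_frame[OF R]) (simp_all add: prems(3))
    have run: "runs choice_loop ?s (\<lambda>t s''. t \<le> (j + 1) * 60 + 20 \<and> choice a b k h j (s'' ''c'' 0) \<and>
      (\<forall>x. x \<notin> {''c'', ''l''} \<longrightarrow> s'' x = ?s x))"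
      using j Aj choice_upto_0[of a b k h j] fr s
      by (intro runs_choice_loop[OF rs h]) (simp_all add: c0_def del: attainable.simps)
    have A0: "s' ''A'' (cell W (p h) j) = 0 \<longleftrightarrow> \<not> attainable a b k h (p h) j"
      "0 < s' ''A'' (cell W (p h) j) \<longleftrightarrow> attainable a b k h (p h) j"
      using Aj[of "p h" j] parent_less[OF h] by auto
    define Q where "Q = (\<lambda>t s''. t \<le> (k + 1) * 60 + 90 \<and> s'' ''j'' 0 = j \<and>
          (\<forall>v<n. \<forall>l\<le>k. s'' ''A'' (cell W v l) \<noteq> 0 \<longleftrightarrow>
            attainable a b k (if v = p h \<and> j \<le> l then Suc h else h) v l) \<and>
          (\<forall>i\<le>h. \<forall>l\<le>k. i < h \<or> j \<le> l \<longrightarrow> choice a b k i l (s'' ''ch'' (cell W i l))))"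
    define tail where "tail = (Write ''ch'' (Plus (Read ''base'' (var ''i'')) (var ''j'')) (var ''c'') ;;
       Write ''A'' (Plus (Read ''base'' (var ''u'')) (var ''j'')) (var ''c''))"
    have post: "runs tail s'' (\<lambda>u. Q (50 + t + u))"
      if t: "t \<le> (j + 1) * 60 + 20" and C: "choice a b k h j (s'' ''c'' 0)"
        and f: "\<forall>x. x \<notin> {''c'', ''l''} \<longrightarrow> s'' x = ?s x" for t s''
    proof -
      have f': "s'' ''i'' 0 = h" "s'' ''u'' 0 = p h" "s'' ''j'' 0 = j" "s'' ''base'' = s ''base''"
        "s'' ''A'' = s' ''A''" "s'' ''ch'' = s' ''ch''"
        using f fr s by simp_all
      have T: "t \<le> (k + 1) * 60 + 20" using t j(3) by simp
      have A2: "(if v = p h \<and> l = j then s'' ''c'' 0 else s' ''A'' (cell W v l)) \<noteq> 0 \<longleftrightarrow>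
            attainable a b k (if v = p h \<and> j \<le> l then Suc h else h) v l" if "v < n" "l \<le> k" for v l
        using A'[OF that] choice_nonzero_iff[OF C] by (cases "v = p h"; cases "l = j") (auto simp del: attainable.simps)
      have C2: "choice a b k i l (if i = h \<and> l = j then s'' ''c'' 0 else s' ''ch'' (cell W i l))"
        if "i \<le> h" "l \<le> k" "i < h \<or> j \<le> l" for i l
        using ch'[of i l] C that by auto
      have "(\<forall>v<n. \<forall>l\<le>k. ((s' ''A'')(cell W (p h) j := s'' ''c'' 0)) (cell W v l) \<noteq> 0 \<longleftrightarrow>
            attainable a b k (if v = p h \<and> j \<le> l then Suc h else h) v l)"
        using A2 j k by (simp add: cell_eq_iff del: attainable.simps split del: if_split)
      moreover have "(\<forall>i\<le>h. \<forall>l\<le>k. i < h \<or> j \<le> l \<longrightarrow>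
          choice a b k i l (((s' ''ch'')(cell W h j := s'' ''c'' 0)) (cell W i l)))"
        using C2 j k by (simp add: cell_eq_iff split del: if_split)
      ultimately show ?thesis using T
        by (simp add: runs_simps tail_def Q_def f' rd del: attainable.simps fun_upd_apply
            add: fun_upd_same fun_upd_other split del: if_split)
    qed
    have Q_mono: "Q t s'' \<Longrightarrow> t' \<le> t \<Longrightarrow> Q t' s''" for t t' s'' by (simp add: Q_def)
    \<comment> \<open>The two branches of the conditional contribute different times. With the
      accumulated time abstracted as \<open>g\<close>, one argument serves both.\<close>
    have rest: "runs choice_loop ?s (\<lambda>t s''. runs tail s'' (\<lambda>u. Q (g t u)))"
      if g: "\<And>t u. g t u \<le> 50 + t + u" for g
    proof (rule runs_mono[OF run], elim conjE)
      fix t s'' assume "t \<le> (j + 1) * 60 + 20" "choice a b k h j (s'' ''c'' 0)"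
        "\<forall>x. x \<notin> {''c'', ''l''} \<longrightarrow> s'' x = ?s x"
      from post[OF this] show "runs tail s'' (\<lambda>u. Q (g t u))"
        by (rule runs_mono) (erule Q_mono, rule g)
    qed
    have "runs (assign ''j'' (Minus (var ''j'') (Const 1)) ;;
     assign ''c'' (Const 0) ;;
     Cond (Conj (Neg (Eq (Read ''A'' (Plus (Read ''base'' (var ''u'')) (var ''j''))) (Const 0)))
         (Less (Read ''sb'' (var ''i'')) (Plus (var ''k'') (Const 1))))
       (assign ''c'' (Const 1)) Skip ;;
     assign ''l'' (Const 0) ;; choice_loop ;; tail) s' Q"
    proof (cases "attainable a b k h (p h) j \<and> sum b (subtree h) \<le> k")
      case True
      then have c0: "c0 = Suc 0" by (simp add: c0_def)
      show ?thesis using True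
        by (simp add: runs_simps sj fr s rd A0 less_Suc_eq_le del: attainable.simps)
          (rule rest[unfolded c0], simp)
    next
      case False
      then have c0: "c0 = 0" by (auto simp: c0_def)
      show ?thesis using False
        by (simp add: runs_simps sj fr s rd A0 less_Suc_eq_le del: attainable.simps)
          (rule conjI, blast, rule rest[unfolded c0], simp)
    qed
    moreover have "bval (Less (Const 0) (var ''j'')) s'" using sj by simp
    ultimately show ?thesis unfolding j(2) tail_def Q_def by (intro conjI)
  qed
  subgoal using s by simp
  subgoal by (simp add: algebra_simps)
  subgoal premises prems for t s'
  proof -
    have A: "s' ''A'' (cell W v j) \<noteq> 0 \<longleftrightarrow> attainable a b k (if v = p h then Suc h else h) v j"
      if "v < n" "j \<le> k" for v j using prems that by (simp del: attainable.simps)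
    have "attainable a b k (if v = p h then Suc h else h) v j \<longleftrightarrow> attainable a b k (Suc h) v j" for v j
      by (cases "v = p h") auto
    then have "tabulated a b W k (Suc h) (s' ''A'')" using A unfolding tabulated_def by blast
    moreover have "choices a b W k (Suc h) (s' ''ch'')"
      using prems by (simp add: choices_def less_Suc_eq_le)
    ultimately show ?thesis using prems by simp
  qed
  done

lemma runs_merge_loop:
  assumes R: "ready a b W s" and k: "k \<le> W" and s: "s ''k'' 0 = k" "s ''i'' 0 = 0"
    and A: "tabulated a b W k 0 (s ''A'')"
  shows "runs merge_loop s (\<lambda>t s'. t \<le> n * ((k + 1) * ((k + 1) * 60 + 100) + 80) + 20 \<and>
    (tabulated a b W k (n - 1) (s' ''A'') \<and> choices a b W k (n - 1) (s' ''ch'')) \<and>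
    (\<forall>x. x \<notin> {''u'', ''j'', ''c'', ''l'', ''ch'', ''A'', ''i''} \<longrightarrow> s' x = s x))"
  unfolding merge_loop_def
  apply (rule runs_mono)
   apply (rule runs_While[where N = "n - 1" and B = "(k + 1) * ((k + 1) * 60 + 100) + 60" and
        T = "n * ((k + 1) * ((k + 1) * 60 + 100) + 80) + 20" and
        I = "\<lambda>m s'. s' ''i'' 0 = m \<and> tabulated a b W k m (s' ''A'') \<and> choices a b W k m (s' ''ch'')"])
  subgoal using s A by (simp add: choices_def)
  subgoal premises prems for m s'
  proof -
    let ?s = "s'(''u'' := (s' ''u'')(0 := p m), ''j'' := (s' ''j'')(0 := k + 1))"
    have m: "Suc m < n" using prems(1) by simp
    have fr: "s' ''k'' = s ''k''" "s' ''n'' = s ''n''" "s' ''par'' = s ''par''" using prems(3) by simp_all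
    have rd: "s ''n'' 0 = n" "s ''par'' m = p m" using R m by (auto simp: ready_def)
    have i: "s' ''i'' 0 = m" and T: "tabulated a b W k m (s' ''A'')" "choices a b W k m (s' ''ch'')"
      using prems(2) by auto
    have rs: "ready a b W ?s" by (rule ready_frame[OF R]) (simp_all add: prems(3))
    have run: "runs row_loop ?s (\<lambda>t s''. t \<le> (k + 1) * ((k + 1) * 60 + 100) + 20 \<and>
      (tabulated a b W k (Suc m) (s'' ''A'') \<and> choices a b W k (Suc m) (s'' ''ch'')) \<and>
      (\<forall>x. x \<notin> {''j'', ''c'', ''l'', ''ch'', ''A''} \<longrightarrow> s'' x = ?s x))"
      using i T fr s by (intro runs_row_loop[OF rs m k]) simp_all
    have "runs (assign ''u'' (Read ''par'' (var ''i'')) ;; assign ''j'' (Plus (var ''k'') (Const 1)) ;;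
        row_loop ;; incr ''i'') s' (\<lambda>t s''. t \<le> (k + 1) * ((k + 1) * 60 + 100) + 60 \<and>
        s'' ''i'' 0 = Suc m \<and> tabulated a b W k (Suc m) (s'' ''A'') \<and> choices a b W k (Suc m) (s'' ''ch''))"
    proof -
      have st: "s'(''u'' := (s' ''u'')(0 := s' ''par'' (s' ''i'' 0)),
          ''j'' := ((s'(''u'' := (s' ''u'')(0 := s' ''par'' (s' ''i'' 0)))) ''j'')
            (0 := (s'(''u'' := (s' ''u'')(0 := s' ''par'' (s' ''i'' 0)))) ''k'' 0 + 1)) = ?s"
        by (simp add: i fr rd s)
      show ?thesis
        unfolding runs_Seq runs_Write[of "''u''"] runs_Write[of "''j''"] aval.simps st
        by (rule runs_mono[OF run]) (simp add: runs_simps i)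
    qed
    then show ?thesis using i fr rd m by simp
  qed
  subgoal using R by (simp add: ready_def)
  subgoal using pos by (cases n) (simp_all add: algebra_simps)
  subgoal by auto
  done

text \<open>Attained weight and threshold are the same number, so \<open>k\<close> is feasible at
  some \<open>u\<close> exactly if there is a connected safe set of weight \<open>k\<close>.\<close>

definition feasible :: "(nat \<Rightarrow> nat) \<Rightarrow> (nat \<Rightarrow> nat) \<Rightarrow> nat \<Rightarrow> nat \<Rightarrow> bool" where
  "feasible a b k u \<longleftrightarrow> u < n \<and> attainable a b k (n - 1) u k \<and> sum b {..<n} \<le> k + sum b (subtree u)"

lemma runs_check_loop:
  assumes R: "ready a b W s" and k: "k \<le> W" and s: "s ''k'' 0 = k" "s ''i'' 0 = 0" "s ''f'' 0 = 0"
    and A: "tabulated a b W k (n - 1) (s ''A'')"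
  shows "runs check_loop s (\<lambda>t s'. t \<le> n * 60 + 20 \<and>
    ((s' ''f'' 0 \<noteq> 0 \<longleftrightarrow> (\<exists>u. feasible a b k u)) \<and> (s' ''f'' 0 \<noteq> 0 \<longrightarrow> feasible a b k (s' ''top'' 0))) \<and>
    (\<forall>x. x \<notin> {''f'', ''top'', ''i''} \<longrightarrow> s' x = s x))"
  unfolding check_loop_def
  apply (rule runs_mono)
   apply (rule runs_While[where N = n and B = 50 and T = "n * 60 + 20" and
        I = "\<lambda>m s'. s' ''i'' 0 = m \<and> (s' ''f'' 0 \<noteq> 0 \<longleftrightarrow> (\<exists>u<m. feasible a b k u)) \<and>
          (s' ''f'' 0 \<noteq> 0 \<longrightarrow> feasible a b k (s' ''top'' 0))"])
  subgoal using s by simp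
  subgoal premises prems for m s'
  proof -
    have fr: "s' ''k'' = s ''k''" "s' ''n'' = s ''n''" "s' ''A'' = s ''A''" "s' ''base'' = s ''base''"
      "s' ''sb'' = s ''sb''" "s' ''tot'' = s ''tot''"
      using prems(3) by simp_all
    have rd: "s ''n'' 0 = n" "s ''sb'' m = sum b (subtree m)" "s ''tot'' 0 = sum b {..<n}"
      "\<And>x. s ''base'' m + x = cell W m x"
      using R prems(1) by (auto simp: ready_def cell_def)
    have i: "s' ''i'' 0 = m" and I: "s' ''f'' 0 \<noteq> 0 \<longleftrightarrow> (\<exists>u<m. feasible a b k u)"
      "s' ''f'' 0 \<noteq> 0 \<longrightarrow> feasible a b k (s' ''top'' 0)" using prems(2) by blast+
    have F: "feasible a b k m \<longleftrightarrow>
        sum b {..<n} - sum b (subtree m) < Suc k \<and> s ''A'' (cell W m k) \<noteq> 0"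
      using A prems(1) by (auto simp: feasible_def tabulated_def)
    show ?thesis
    proof (cases "feasible a b k m")
      case True
      then show ?thesis using True[unfolded F] prems(1)
        by (auto simp: runs_simps fr rd i s)
    next
      case False
      have ex: "(\<exists>u<Suc m. feasible a b k u) \<longleftrightarrow> (\<exists>u<m. feasible a b k u)"
        using False less_Suc_eq by blast
      have no: "sum b {..<n} - sum b (subtree m) < Suc k \<longrightarrow> s ''A'' (cell W m k) = 0" using False F by simp
      show ?thesis unfolding ex using no prems(1) I by (simp add: runs_simps fr rd i s) auto
    qed
  qed
  subgoal using R by (simp add: ready_def)
  subgoal by simp
  subgoal by (auto simp: feasible_def)
  done

lemma runs_search_loop:
  assumes R: "ready a b W s" and s: "s ''k'' 0 = 0" "s ''f'' 0 = 0"
    and r: "r \<le> W" "feasible a b r v" and least: "\<And>k u. k < r \<Longrightarrow> \<not> feasible a b k u"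
  shows "runs search_loop s (\<lambda>t s'. t \<le> (W + 1) * (n * ((W + 1) * (W + 1) * 60 + (W + 1) * 140 + 300) + 200) + 20 \<and>
    (s' ''k'' 0 = r \<and> feasible a b r (s' ''top'' 0) \<and> choices a b W r (n - 1) (s' ''ch'')) \<and>
    (\<forall>x. x \<notin> {''u'', ''j'', ''c'', ''l'', ''ch'', ''A'', ''i'', ''f'', ''top'', ''k''} \<longrightarrow> s' x = s x))"
  unfolding search_loop_def
  apply (rule runs_mono)
   \<comment> \<open>Round \<open>m\<close> examines weight \<open>m\<close>, and only round
     \<open>r\<close> sets the flag, hence \<open>Suc r\<close> rounds. That last round leaves
     \<open>k\<close> unchanged, which is why the invariant has a separate form for
     \<open>m = Suc r\<close>.\<close>
   apply (rule runs_While[where N = "Suc r" and B = "n * ((W + 1) * (W + 1) * 60 + (W + 1) * 140 + 300) + 150" and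
        T = "Suc r * (n * ((W + 1) * (W + 1) * 60 + (W + 1) * 140 + 300) + 200) + 20" and
        I = "\<lambda>m s'. if m \<le> r then s' ''k'' 0 = m \<and> s' ''f'' 0 = 0
          else s' ''f'' 0 \<noteq> 0 \<and> s' ''k'' 0 = r \<and> feasible a b r (s' ''top'' 0) \<and> choices a b W r (n - 1) (s' ''ch'')"])
  subgoal using s by simp
  subgoal premises prems for m s'
  proof -
    have m: "m \<le> r" "m \<le> W" using prems(1) r by auto
    have k: "s' ''k'' 0 = m" and f: "s' ''f'' 0 = 0" using prems(2) m by auto
    let ?fr = "\<lambda>s''. s'' ''n'' = s ''n'' \<and> s'' ''tot'' = s ''tot'' \<and> s'' ''par'' = s ''par'' \<and>
      s'' ''a'' = s ''a'' \<and> s'' ''sb'' = s ''sb'' \<and> s'' ''base'' = s ''base''"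
    have rdy: "ready a b W s''" if "?fr s''" for s'' using that by (intro ready_frame[OF R]) simp_all
    have fr: "?fr s'" using prems(3) by simp
    have init: "runs (assign ''i'' (Const 0) ;; init_loop) s' (\<lambda>t s''. t \<le> n * ((m + 1) * 40 + 60) + 30 \<and>
      (tabulated a b W m 0 (s'' ''A'') \<and> ?fr s'' \<and> s'' ''k'' 0 = m \<and> s'' ''f'' 0 = 0))"
    proof -
      let ?s = "s'(''i'' := (s' ''i'')(0 := 0))"
      have "ready a b W ?s" using fr by (intro rdy) simp
      note run = runs_init_loop[OF this _ m(2)]
      show ?thesis unfolding runs_Seq runs_Write[of "''i''"] aval.simps
        by (rule runs_mono[OF run]) (use k f fr in \<open>auto simp: tabulated_def\<close>)
    qed
    have merge: "runs (assign ''i'' (Const 0) ;; merge_loop) s1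
      (\<lambda>t s''. t \<le> n * ((m + 1) * ((m + 1) * 60 + 100) + 80) + 30 \<and>
      (tabulated a b W m (n - 1) (s'' ''A'') \<and> choices a b W m (n - 1) (s'' ''ch'') \<and> ?fr s'' \<and>
       s'' ''k'' 0 = m \<and> s'' ''f'' 0 = 0))"
      if h: "tabulated a b W m 0 (s1 ''A'') \<and> ?fr s1 \<and> s1 ''k'' 0 = m \<and> s1 ''f'' 0 = 0" for s1
    proof -
      let ?s = "s1(''i'' := (s1 ''i'')(0 := 0))"
      have "ready a b W ?s" using h by (intro rdy) simp
      note run = runs_merge_loop[OF this m(2)]
      show ?thesis unfolding runs_Seq runs_Write[of "''i''"] aval.simps
        by (rule runs_mono[OF run]) (use h in auto)
    qed
    have check: "runs (assign ''i'' (Const 0) ;; check_loop) s1 (\<lambda>t s''. t \<le> n * 60 + 30 \<and>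
      (((s'' ''f'' 0 \<noteq> 0 \<longleftrightarrow> (\<exists>u. feasible a b m u)) \<and> (s'' ''f'' 0 \<noteq> 0 \<longrightarrow> feasible a b m (s'' ''top'' 0))) \<and>
       choices a b W m (n - 1) (s'' ''ch'') \<and> s'' ''k'' 0 = m))"
      if h: "tabulated a b W m (n - 1) (s1 ''A'') \<and> choices a b W m (n - 1) (s1 ''ch'') \<and> ?fr s1 \<and>
       s1 ''k'' 0 = m \<and> s1 ''f'' 0 = 0" for s1
    proof -
      let ?s = "s1(''i'' := (s1 ''i'')(0 := 0))"
      have "ready a b W ?s" using h by (intro rdy) simp
      note run = runs_check_loop[OF this m(2)]
      show ?thesis unfolding runs_Seq runs_Write[of "''i''"] aval.simps
        by (rule runs_mono[OF run]) (use h in auto)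
    qed
    have last: "runs (Cond (Eq (var ''f'') (Const 0)) (incr ''k'') Skip) s1 (\<lambda>t s''. t \<le> 20 \<and>
       (if Suc m \<le> r then s'' ''k'' 0 = Suc m \<and> s'' ''f'' 0 = 0
          else s'' ''f'' 0 \<noteq> 0 \<and> s'' ''k'' 0 = r \<and> feasible a b r (s'' ''top'' 0) \<and> choices a b W r (n - 1) (s'' ''ch'')))"
      if h: "((s1 ''f'' 0 \<noteq> 0 \<longleftrightarrow> (\<exists>u. feasible a b m u)) \<and> (s1 ''f'' 0 \<noteq> 0 \<longrightarrow> feasible a b m (s1 ''top'' 0))) \<and>
       choices a b W m (n - 1) (s1 ''ch'') \<and> s1 ''k'' 0 = m" for s1
    proof (cases "m = r")
      case True
      then have "s1 ''f'' 0 \<noteq> 0" using h r(2) by blast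
      then show ?thesis using h True by (simp add: runs_simps)
    next
      case False
      then have "m < r" using m by simp
      then have "s1 ''f'' 0 = 0" using h least by blast
      then show ?thesis using h \<open>m < r\<close> by (simp add: runs_simps)
    qed
    \<comment> \<open>The summands are the costs per vertex of initialising, merging and checking
      for \<open>k = m\<close>; passing from \<open>m\<close> to \<open>W\<close> makes the bound
      independent of the round.\<close>
    have "X * 40 + 60 + (X * (X * 60 + 100) + 80 + 60) \<le> Y * Y * 60 + Y * 140 + 300"
      if "X \<le> Y" for X Y :: nat
    proof -
      have "X * X \<le> Y * Y" using that by (rule mult_le_mono[OF that])
      moreover have "X * (X * 60 + 100) = X * X * 60 + X * 100" by (simp add: algebra_simps)
      ultimately show ?thesis using that by linarith
    qed
    from this[of "m + 1" "W + 1"] m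
    have c: "(m + 1) * 40 + 60 + ((m + 1) * ((m + 1) * 60 + 100) + 80 + 60)
        \<le> (W + 1) * (W + 1) * 60 + (W + 1) * 140 + 300"
      by (simp only: add_le_cancel_right)
    have cost: "n * ((m + 1) * 40 + 60) + 30 + (n * ((m + 1) * ((m + 1) * 60 + 100) + 80) + 30 +
        (n * 60 + 30 + 20)) \<le> n * ((W + 1) * (W + 1) * 60 + (W + 1) * 140 + 300) + 150"
      using mult_le_mono2[OF c, of n] unfolding distrib_left by linarith
    \<comment> \<open>Every loop is grouped with the reset of its counter, so that the
      specifications above compose by \<open>runs_SeqI\<close>.\<close>
    have assoc: "runs (c1 ;; c2 ;; c3 ;; c4 ;; c5 ;; c6 ;; c7) s' Z \<longleftrightarrow>
      runs ((c1 ;; c2) ;; (c3 ;; c4) ;; (c5 ;; c6) ;; c7) s' Z" for c1 c2 c3 c4 c5 c6 c7 Z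
      by (simp add: runs_Seq add.assoc)
    show ?thesis
      unfolding assoc
      by (rule conjI, simp add: f, rule runs_SeqI[OF init runs_SeqI[OF merge runs_SeqI[OF check last order_refl] order_refl] cost])
  qed
  subgoal by simp
  subgoal by (simp add: algebra_simps)
  subgoal premises prems for t s'
  proof -
    have "Suc r * (n * ((W + 1) * (W + 1) * 60 + (W + 1) * 140 + 300) + 200)
      \<le> (W + 1) * (n * ((W + 1) * (W + 1) * 60 + (W + 1) * 140 + 300) + 200)"
      using r by (intro mult_le_mono1) simp
    moreover note prems[THEN conjunct1]
    ultimately have "t \<le> (W + 1) * (n * ((W + 1) * (W + 1) * 60 + (W + 1) * 140 + 300) + 200) + 20"
      by linarith
    moreover note prems[THEN conjunct2]
    ultimately show ?thesis by simp
  qed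
  done

lemma runs_trace_loop:
  assumes R: "ready a b W s" and r: "r \<le> W" and s: "s ''i'' 0 = n - 1"
    and F: "feasible a b r u" and ch: "choices a b W r (n - 1) (s ''ch'')"
    and T: "traced a b r u (n - 1) {x. s ''sel'' x \<noteq> 0} (s ''cur'')"
  shows "runs trace_loop s (\<lambda>t s'. t \<le> n * 80 + 20 \<and>
    (top_safe b r u {x. s' ''sel'' x \<noteq> 0} \<and> sum a {x. s' ''sel'' x \<noteq> 0} = r) \<and>
    (\<forall>x. x \<notin> {''i'', ''u'', ''c'', ''sel'', ''cur''} \<longrightarrow> s' x = s x))"
  unfolding trace_loop_def
  apply (rule runs_mono)
   apply (rule runs_While[where N = "n - 1" and B = 70 and T = "n * 80 + 20" and
        I = "\<lambda>m s'. s' ''i'' 0 = n - 1 - m \<and> traced a b r u (n - 1 - m) {x. s' ''sel'' x \<noteq> 0} (s' ''cur'')"])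
  subgoal using s T by simp
  subgoal premises prems for m s'
  proof -
    define h where "h = n - 1 - Suc m"
    have h: "Suc h < n" "n - 1 - m = Suc h" using prems(1) by (auto simp: h_def)
    have fr: "s' ''par'' = s ''par''" "s' ''base'' = s ''base''" "s' ''ch'' = s ''ch''"
      using prems(3) by simp_all
    have rd: "s ''par'' h = p h" "\<And>x. s ''base'' h + x = cell W h x"
      using R h by (auto simp: ready_def cell_def)
    have i: "s' ''i'' 0 = Suc h" and T': "traced a b r u (Suc h) {x. s' ''sel'' x \<noteq> 0} (s' ''cur'')"
      using prems(2) unfolding h by auto
    have ph: "p h \<noteq> h" using parent_greater[OF h(1)] by simp
    show ?thesis
    proof (cases "s' ''sel'' (p h) = 0")
      case True
      then have "traced a b r u h {x. s' ''sel'' x \<noteq> 0} (s' ''cur'')"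
        using traced_skip[OF T' h(1)] by simp
      then show ?thesis unfolding h_def[symmetric] using True
        by (simp add: runs_simps i fr rd)
    next
      case False
      then have sel: "p h \<in> {x. s' ''sel'' x \<noteq> 0}" by simp
      have fin: "finite {x. s' ''sel'' x \<noteq> 0}"
        using T' by (auto simp: traced_def intro: finite_subset[of _ "{..u}"])
      let ?j = "s' ''cur'' (p h)"
      \<comment> \<open>The remaining weights of the selected vertices sum to \<open>r\<close>, so
        each of them is a valid column of the table of choices.\<close>
      have "?j \<le> sum (s' ''cur'') {x. s' ''sel'' x \<noteq> 0}" using sel fin by (intro member_le_sum) auto
      also have "\<dots> = r" using T' by (simp only: traced_def)
      finally have j: "?j \<le> r" .
      define c where "c = s ''ch'' (cell W h ?j)"
      have C: "choice a b r h ?j c" using ch h j unfolding choices_def c_def by auto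
      have att: "attainable a b r (Suc h) (p h) ?j" using T' sel unfolding traced_def by blast
      have c0: "c \<noteq> 0" using choice_nonzero_iff[OF C] att by blast
      show ?thesis
      proof (cases "1 < c")
        case True
        then have "traced a b r u h (insert h {x. s' ''sel'' x \<noteq> 0})
            ((s' ''cur'')(h := c - 2, p h := ?j - (c - 2)))"
          using C by (intro traced_select[OF T' h(1) sel]) (auto simp: choice_def choice_upto_def)
        moreover have "insert h {x. s' ''sel'' x \<noteq> 0} = {x. ((s' ''sel'')(h := 1)) x \<noteq> 0}" by auto
        ultimately have "traced a b r u h {x. ((s' ''sel'')(h := Suc 0)) x \<noteq> 0}
            ((s' ''cur'')(h := c - 2, p h := ?j - (c - 2)))" by simp
        then show ?thesis unfolding h_def[symmetric] using False True ph
          by (simp add: runs_simps i fr rd c_def[symmetric] del: fun_upd_apply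
              add: fun_upd_same fun_upd_other)
      next
        case c1: False
        then have "c = 1" using c0 by simp
        then have "traced a b r u h {x. s' ''sel'' x \<noteq> 0} (s' ''cur'')"
          using C by (intro traced_reject[OF T' h(1) sel]) (auto simp: choice_def choice_upto_def)
        then show ?thesis unfolding h_def[symmetric] using False c1
          by (simp add: runs_simps i fr rd c_def[symmetric])
      qed
    qed
  qed
  subgoal by simp
  subgoal by simp
  subgoal premises prems for t s'
  proof -
    have "traced a b r u 0 {x. s' ''sel'' x \<noteq> 0} (s' ''cur'')" using prems by simp
    from traced_final[OF this] F prems show ?thesis by (simp add: feasible_def)
  qed
  done

end

lemma runs_output_loop:
  assumes "s ''n'' 0 = n" "s ''i'' 0 = 0" "bij_betw (s ''q'') {..<n} {..<n}"
  shows "runs output_loop s (\<lambda>t s'. t \<le> n * 40 + 20 \<and>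
    output_set n s' = s ''q'' ` {i. i < n \<and> s ''sel'' i \<noteq> 0})"
  unfolding output_loop_def
  apply (rule runs_mono)
   apply (rule runs_While[where N = n and B = 30 and T = "n * 40 + 20" and
        I = "\<lambda>m s'. s' ''i'' 0 = m \<and> (\<forall>i<m. s' ''out'' (s ''q'' i) = s ''sel'' i)"])
  subgoal using assms by simp
  subgoal premises prems for m s'
  proof -
    have fr: "s' ''n'' = s ''n''" "s' ''q'' = s ''q''" "s' ''sel'' = s ''sel''" using prems(3) by simp_all
    have ne: "s ''q'' i \<noteq> s ''q'' m" if "i < m" for i
      using that prems(1) bij_betw_imp_inj_on[OF assms(3)] by (auto simp: inj_on_def)
    have i: "s' ''i'' 0 = m" and o: "\<And>i. i < m \<Longrightarrow> s' ''out'' (s ''q'' i) = s ''sel'' i"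
      using prems(2) by auto
    show ?thesis using prems(1) by (auto simp: runs_simps fr i assms(1) o less_Suc_eq dest: ne)
  qed
  subgoal using assms by simp
  subgoal by simp
  subgoal premises prems for t s'
  proof -
    have o: "\<And>i. i < n \<Longrightarrow> s' ''out'' (s ''q'' i) = s ''sel'' i" using prems by simp
    have im: "s ''q'' ` {..<n} = {..<n}" using assms(3) by (simp add: bij_betw_def)
    have "output_set n s' = {v \<in> s ''q'' ` {..<n}. s' ''out'' v \<noteq> 0}"
      unfolding im by (auto simp: output_set_def)
    also have "\<dots> = s ''q'' ` {i. i < n \<and> s ''sel'' i \<noteq> 0}" using o by auto
    finally show ?thesis using prems by simp
  qed
  done

section \<open>The algorithm\<close>

definition order_phase :: com where
  "order_phase = degree_loop ;; queue_loop ;; (assign ''i'' (Const 0) ;; peel_loop)"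

definition prepare_phase :: com where
  "prepare_phase = (assign ''i'' (Const 0) ;; relabel_loop) ;; (assign ''i'' (Const 0) ;; parent_loop) ;;
     assign ''tot'' (Read ''sb'' (Minus (var ''n'') (Const 1)))"

definition trace_phase :: com where
  "trace_phase = (Write ''cur'' (var ''top'') (var ''k'') ;; Write ''sel'' (var ''top'') (Const 1) ;;
     assign ''i'' (Minus (var ''n'') (Const 1)) ;; trace_loop)"

definition solve :: com where
  "solve = order_phase ;; prepare_phase ;; search_loop ;; trace_phase ;; (assign ''i'' (Const 0) ;; output_loop)"

section \<open>A fixed input instance and the composition of the phases\<close>

locale safe_set_instance =
  fixes n :: nat and T :: "nat pair_pre_digraph" and es :: "(nat \<times> nat) list"
    and wm wp :: "nat \<Rightarrow> nat" and W :: nat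
  assumes tree: "undirected_tree T" and verts: "pverts T = {..<n}" and edge_list: "is_edge_list T es"
begin

lemma graph: "pair_graph T"
  using tree by (simp add: undirected_tree_def)

lemma n_pos: "0 < n"
  using undirected_tree_cut_connected[OF tree] verts by (auto simp: cut_connected_def)

lemma parcs_subset: "parcs T \<subseteq> {..<n} \<times> {..<n}"
proof -
  interpret pair_graph T by (rule graph)
  show ?thesis using in_arcsD1 in_arcsD2 verts by fastforce
qed

lemma no_loop: "(x, x) \<notin> parcs T"
proof -
  interpret pair_graph T by (rule graph)
  show ?thesis using pair_no_loops[of "(x, x)"] by auto
qed

sublocale leafy_graph n "parcs T"
  using pair_graph_sym[OF graph] no_loop parcs_subset low_degree_vertex[OF tree] verts
  by unfold_locales auto

lemma length_es: "length es \<le> n"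
  using length_edge_list_le[OF tree edge_list] verts by simp

lemma edge_sum_eq: "edge_sum g es (length es) v = sum g (nbrs (parcs T) {..<n} v)"
  using sum_edge_list[OF graph edge_list, of v g] by (simp add: edge_sum_def verts)

abbreviation start :: state where
  "start \<equiv> input_state n es wm wp W"

abbreviation order_arrays :: "string set" where
  "order_arrays \<equiv> {''x'', ''y'', ''e'', ''deg'', ''ns'', ''i'', ''t'', ''q''}"

lemma runs_order_phase:
  "runs order_phase start (\<lambda>t s. t \<le> n * 160 + 180 \<and>
    (peeled n (parcs T) (s ''q'') (s ''t'' 0) (s ''deg'') (s ''ns'') (n - 1) \<and>
     (\<forall>x. x \<notin> order_arrays \<longrightarrow> s x = start x)))"
proof -
  have es: "fst (es ! i) \<noteq> snd (es ! i)" if "i < length es" for i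
  proof -
    have "es ! i \<in> parcs T" using that edge_list by (auto simp: is_edge_list_def)
    then show ?thesis using no_loop by (metis prod.collapse)
  qed
  have 1: "runs degree_loop start (\<lambda>t s. t \<le> length es * 60 + 60 \<and>
    (s ''deg'' = edge_sum (\<lambda>_. 1) es (length es) \<and> s ''ns'' = edge_sum (\<lambda>y. y) es (length es) \<and>
    (\<forall>a. a \<notin> {''x'', ''y'', ''e'', ''deg'', ''ns''} \<longrightarrow> s a = start a)))"
    using es by (intro runs_degree_loop) (auto simp: input_state_def)
  have 2: "runs queue_loop s1 (\<lambda>t s. t \<le> n * 40 + 40 \<and>
      (peeled n (parcs T) (s ''q'') (s ''t'' 0) (s ''deg'') (s ''ns'') 0 \<and>
      (\<forall>x. x \<notin> order_arrays \<longrightarrow> s x = start x)))"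
    if h: "s1 ''deg'' = edge_sum (\<lambda>_. 1) es (length es) \<and> s1 ''ns'' = edge_sum (\<lambda>y. y) es (length es) \<and>
      (\<forall>a. a \<notin> {''x'', ''y'', ''e'', ''deg'', ''ns''} \<longrightarrow> s1 a = start a)" for s1
  proof -
    have st: "s1 ''n'' 0 = n" "s1 ''i'' 0 = 0" "s1 ''t'' 0 = 0" using h by (auto simp: input_state_def)
    have deg: "s1 ''deg'' v = card (nbrs (parcs T) {..<n} v)" "s1 ''ns'' v = \<Sum>(nbrs (parcs T) {..<n} v)" for v
      using h by (simp_all add: edge_sum_eq)
    show ?thesis
    proof (rule runs_mono[OF runs_queue_loop[of s1 n, OF st]], elim conjE, intro conjI)
      fix t s
      assume t: "t \<le> n * 40 + 40" and inj: "inj_on (s ''q'') {..<s ''t'' 0}"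
        and im: "s ''q'' ` {..<s ''t'' 0} = {v. v < n \<and> s1 ''deg'' v < 2}"
        and f: "\<forall>a. a \<notin> {''i'', ''t'', ''q''} \<longrightarrow> s a = s1 a"
      show "t \<le> n * 40 + 40" by fact
      have "s ''deg'' = s1 ''deg''" "s ''ns'' = s1 ''ns''" using f by simp_all
      then show "peeled n (parcs T) (s ''q'') (s ''t'' 0) (s ''deg'') (s ''ns'') 0"
        using inj im n_pos undirected_tree_cut_connected[OF tree]
        by (auto simp: peeled_def Let_def deg verts lessThan_atLeast0 numeral_2_eq_2 less_Suc_eq_le)
      show "\<forall>x. x \<notin> order_arrays \<longrightarrow> s x = start x" using f h by simp
    qed
  qed
  have 3: "runs (assign ''i'' (Const 0) ;; peel_loop) s1 (\<lambda>t s. t \<le> n * 60 + 70 \<and>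
      (peeled n (parcs T) (s ''q'') (s ''t'' 0) (s ''deg'') (s ''ns'') (n - 1) \<and>
      (\<forall>x. x \<notin> order_arrays \<longrightarrow> s x = start x)))"
    if h: "peeled n (parcs T) (s1 ''q'') (s1 ''t'' 0) (s1 ''deg'') (s1 ''ns'') 0 \<and>
      (\<forall>x. x \<notin> order_arrays \<longrightarrow> s1 x = start x)" for s1
  proof -
    let ?s = "s1(''i'' := (s1 ''i'')(0 := 0))"
    have "s1 ''n'' = start ''n''" using h by simp
    then have st: "?s ''n'' 0 = n" "?s ''i'' 0 = 0" by (simp_all add: input_state_def)
    show ?thesis unfolding runs_Seq runs_Write aval.simps
      by (rule runs_mono[OF runs_peel_loop[of ?s, OF st]]) (use h in auto)
  qed
  show ?thesis unfolding order_phase_def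
    by (rule runs_SeqI[OF 1 runs_SeqI[OF 2 3 order_refl]]) (use length_es in auto)
qed

end

text \<open>Fixes the arrays left by the peeling phase, so that the rooted tree they describe is
  available when the later phases are specified.\<close>

locale ordered_instance = safe_set_instance +
  fixes q ns :: "nat \<Rightarrow> nat" and t :: nat and deg :: "nat \<Rightarrow> nat"
  assumes peeled: "peeled n (parcs T) q t deg ns (n - 1)"
begin

abbreviation "p \<equiv> parent q ns"

sublocale increasing_tree n "parent q ns"
  by (rule peeled_final[OF peeled])

lemma bij: "bij_betw q {..<n} {..<n}"
  by (rule peeled_final[OF peeled])

lemma parcs_eq: "parcs T = map_prod q q ` edges"
  by (rule peeled_final[OF peeled])

lemma q_less: "i < n \<Longrightarrow> q i < n"
  using bij_betwE[OF bij] by auto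

abbreviation a :: "nat \<Rightarrow> nat" where "a \<equiv> wm \<circ> q"
abbreviation b :: "nat \<Rightarrow> nat" where "b \<equiv> wp \<circ> q"

lemma edges_subset: "edges \<subseteq> {..<n} \<times> {..<n}"
  using parent_less by (auto simp: edges_def)

lemma connected_safe_set_image_iff:
  assumes "S \<subseteq> {..<n}"
  shows "connected_safe_set T wm wp (q ` S) \<longleftrightarrow> (\<exists>u. top_safe b (sum a S) u S)"
  using connected_safe_set_iff[OF tree, of wm wp "q ` S"] cut_safe_image[OF bij edges_subset assms, of wm wp]
    cut_safe_iff_top_safe[of a b S]
  by (simp add: verts parcs_eq)

lemma sum_image: "S \<subseteq> {..<n} \<Longrightarrow> sum wm (q ` S) = sum a S"
  using bij by (metis bij_betw_def inj_on_subset sum.reindex)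

lemma connected_safe_set_feasible:
  assumes "connected_safe_set T wm wp S"
  shows "\<exists>u. feasible a b (sum wm S) u"
proof -
  have "S \<subseteq> {..<n}" using assms verts by (simp add: connected_safe_set_def safe_set_def)
  then have "S \<subseteq> q ` {..<n}" using bij by (simp add: bij_betw_def)
  then obtain S' where S': "S' \<subseteq> {..<n}" "S = q ` S'" by (meson subset_imageE)
  then obtain u where u: "top_safe b (sum a S') u S'" using assms connected_safe_set_image_iff by auto
  then have "feasible a b (sum a S') u"
    using top_safe_imp_attainable[OF u, of a] by (simp add: feasible_def top_safe_def)
  then show ?thesis using S' sum_image by auto
qed

text \<open>Every connected safe set makes its own weight feasible, so none is lighter than the
  first feasible \<open>r\<close>.\<close>

lemma min_connected_safe_setI:
  assumes "top_safe b r u S" "sum a S = r" and least: "\<And>k u. k < r \<Longrightarrow> \<not> feasible a b k u"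
  shows "min_connected_safe_set T wm wp (q ` S)"
proof -
  have S: "S \<subseteq> {..<n}" using assms(1) by (auto simp: top_safe_def)
  have "connected_safe_set T wm wp (q ` S)" using assms(1,2) connected_safe_set_image_iff[OF S] by auto
  moreover have "sum wm (q ` S) \<le> sum wm S'" if "connected_safe_set T wm wp S'" for S'
    using connected_safe_set_feasible[OF that] least sum_image[OF S] assms(2) not_le by metis
  ultimately show ?thesis by (simp add: min_connected_safe_set_def)
qed

abbreviation prepared :: "state \<Rightarrow> bool" where
  "prepared s \<equiv> ready a b W s \<and> s ''q'' = q \<and> s ''sel'' = (\<lambda>_. 0)"

lemma runs_prepare_phase:
  assumes s: "s ''q'' = q" "s ''ns'' = ns" "\<And>x. x \<notin> order_arrays \<Longrightarrow> s x = start x"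
  shows "runs prepare_phase s (\<lambda>t s. t \<le> n * 120 + 160 \<and>
    (prepared s \<and> s ''k'' 0 = 0 \<and> s ''f'' 0 = 0))"
proof -
  have n: "s ''n'' 0 = n" and W: "s ''W'' 0 = W" and base: "s ''base'' 0 = 0"
    and rest: "s ''sel'' = (\<lambda>_. 0)" "s ''k'' 0 = 0" "s ''f'' 0 = 0"
    and w: "s ''wm'' = (\<lambda>i. if i < n then wm i else 0)" "s ''wp'' = (\<lambda>i. if i < n then wp i else 0)"
    using s(3) by (simp_all add: input_state_def)
  let ?keep = "\<lambda>s'. s' ''n'' 0 = n \<and> s' ''q'' = q \<and> s' ''ns'' = ns \<and> s' ''sel'' = (\<lambda>_. 0) \<and>
    s' ''k'' 0 = 0 \<and> s' ''f'' 0 = 0"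
  have 1: "runs (assign ''i'' (Const 0) ;; relabel_loop) s (\<lambda>t s'. t \<le> n * 60 + 70 \<and>
    ((\<forall>i<n. s' ''pos'' (q i) = i \<and> s' ''a'' i = a i \<and> s' ''sb'' i = b i \<and> s' ''base'' i = i * (W + 1)) \<and> ?keep s'))"
  proof -
    let ?s = "s(''i'' := (s ''i'')(0 := 0))"
    have inj: "inj_on (?s ''q'') {..<n}" using bij s(1) by (simp add: bij_betw_def)
    have "runs relabel_loop ?s (\<lambda>t s'. t \<le> n * 60 + 60 \<and>
      (\<forall>i<n. s' ''pos'' (?s ''q'' i) = i \<and> s' ''a'' i = ?s ''wm'' (?s ''q'' i) \<and>
       s' ''sb'' i = ?s ''wp'' (?s ''q'' i) \<and> s' ''base'' i = i * (W + 1)) \<and>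
      (\<forall>a. a \<notin> {''i'', ''pos'', ''a'', ''sb'', ''base''} \<longrightarrow> s' a = ?s a))"
      using n W base inj by (intro runs_relabel_loop) simp_all
    then show ?thesis unfolding runs_Seq runs_Write aval.simps
      by (rule runs_mono) (use n rest w s(1,2) q_less in auto)
  qed
  have 2: "runs (assign ''i'' (Const 0) ;; parent_loop) s1 (\<lambda>t s'. t \<le> n * 60 + 70 \<and>
    ((\<forall>i. Suc i < n \<longrightarrow> s' ''par'' i = p i) \<and>
     (\<forall>i<n. s' ''a'' i = a i \<and> s' ''sb'' i = sum b (subtree i) \<and> s' ''base'' i = i * (W + 1)) \<and> ?keep s'))"
    if h: "(\<forall>i<n. s1 ''pos'' (q i) = i \<and> s1 ''a'' i = a i \<and> s1 ''sb'' i = b i \<and> s1 ''base'' i = i * (W + 1)) \<and> ?keep s1"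
    for s1
  proof -
    let ?s = "s1(''i'' := (s1 ''i'')(0 := 0))"
    have par: "s1 ''pos'' (ns (q i)) = p i" if "Suc i < n" for i
      using h parent_less[OF that] peeled_final(3)[OF peeled that] by metis
    have "runs parent_loop ?s (\<lambda>t s'. t \<le> n * 60 + 60 \<and>
      ((\<forall>i. Suc i < n \<longrightarrow> s' ''par'' i = p i) \<and> (\<forall>v<n. s' ''sb'' v = sum b (subtree v))) \<and>
      (\<forall>a. a \<notin> {''i'', ''par'', ''sb''} \<longrightarrow> s' a = ?s a))"
      using h par by (intro runs_parent_loop) simp_all
    then show ?thesis unfolding runs_Seq runs_Write aval.simps
      by (rule runs_mono) (use h in auto)
  qed
  have 3: "runs (assign ''tot'' (Read ''sb'' (Minus (var ''n'') (Const 1)))) s1 (\<lambda>t s'. t \<le> 20 \<and>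
    (prepared s' \<and> s' ''k'' 0 = 0 \<and> s' ''f'' 0 = 0))"
    if h: "(\<forall>i. Suc i < n \<longrightarrow> s1 ''par'' i = p i) \<and>
     (\<forall>i<n. s1 ''a'' i = a i \<and> s1 ''sb'' i = sum b (subtree i) \<and> s1 ''base'' i = i * (W + 1)) \<and> ?keep s1" for s1
  proof -
    have "s1 ''sb'' (n - 1) = sum b {..<n}" using h n_pos subtree_root by simp
    then show ?thesis using h by (simp add: runs_simps ready_def)
  qed
  show ?thesis unfolding prepare_phase_def
    by (rule runs_SeqI[OF 1 runs_SeqI[OF 2 3 order_refl]]) auto
qed

lemma runs_search:
  assumes s: "prepared s \<and> s ''k'' 0 = 0 \<and> s ''f'' 0 = 0"
    and r: "r \<le> W" "feasible a b r v" and least: "\<And>k u. k < r \<Longrightarrow> \<not> feasible a b k u"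
  shows "runs search_loop s (\<lambda>t s'. t \<le> (W + 1) * (n * ((W + 1) * (W + 1) * 60 + (W + 1) * 140 + 300) + 200) + 20 \<and>
    (prepared s' \<and> s' ''k'' 0 = r \<and> feasible a b r (s' ''top'' 0) \<and> choices a b W r (n - 1) (s' ''ch'')))"
proof -
  have R: "ready a b W s" and k: "s ''k'' 0 = 0" "s ''f'' 0 = 0" using s by auto
  have *: "ready a b W s'" if "\<forall>x. x \<notin> {''u'', ''j'', ''c'', ''l'', ''ch'', ''A'', ''i'', ''f'', ''top'', ''k''} \<longrightarrow> s' x = s x" for s'
    by (rule ready_frame[OF R]) (use that in simp_all)
  show ?thesis
    by (rule runs_mono[OF runs_search_loop[OF R k r least]], assumption, elim conjE, frule *) (use s in auto)
qed

lemma runs_trace_phase: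
  assumes s: "prepared s \<and> s ''k'' 0 = r \<and> feasible a b r (s ''top'' 0) \<and> choices a b W r (n - 1) (s ''ch'')"
    and r: "r \<le> W"
  shows "runs trace_phase s (\<lambda>t s'. t \<le> n * 80 + 50 \<and>
    (s' ''n'' 0 = n \<and> s' ''q'' = q \<and> (\<exists>u. top_safe b r u {x. s' ''sel'' x \<noteq> 0}) \<and> sum a {x. s' ''sel'' x \<noteq> 0} = r))"
proof -
  let ?u = "s ''top'' 0"
  let ?s = "s(''cur'' := (s ''cur'')(?u := r), ''sel'' := (s ''sel'')(?u := 1), ''i'' := (s ''i'')(0 := n - 1))"
  have R: "ready a b W s" and F: "feasible a b r ?u" and n: "s ''n'' 0 = n" and q: "s ''q'' = q"
    using s by (auto simp: ready_def)
  have R': "ready a b W ?s" by (rule ready_frame[OF R]) simp_all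
  have "{x. ?s ''sel'' x \<noteq> 0} = {?u}" using s by auto
  moreover have "traced a b r ?u (n - 1) {?u} (?s ''cur'')"
    using F by (intro traced_init) (auto simp: feasible_def)
  ultimately have "traced a b r ?u (n - 1) {x. ?s ''sel'' x \<noteq> 0} (?s ''cur'')" by simp
  then have run: "runs trace_loop ?s (\<lambda>t s'. t \<le> n * 80 + 20 \<and>
    (top_safe b r ?u {x. s' ''sel'' x \<noteq> 0} \<and> sum a {x. s' ''sel'' x \<noteq> 0} = r) \<and>
    (\<forall>x. x \<notin> {''i'', ''u'', ''c'', ''sel'', ''cur''} \<longrightarrow> s' x = ?s x))"
    using s by (intro runs_trace_loop[OF R' r _ F]) simp_all
  have st: "s(''cur'' := (s ''cur'')(?u := s ''k'' 0),
      ''sel'' := ((s(''cur'' := (s ''cur'')(?u := s ''k'' 0))) ''sel'')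
        ((s(''cur'' := (s ''cur'')(?u := s ''k'' 0))) ''top'' 0 := 1)) =
      s(''cur'' := (s ''cur'')(?u := r), ''sel'' := (s ''sel'')(?u := 1))"
    using s by simp
  have st2: "(s(''cur'' := (s ''cur'')(?u := r), ''sel'' := (s ''sel'')(?u := 1)))
    (''i'' := ((s(''cur'' := (s ''cur'')(?u := r), ''sel'' := (s ''sel'')(?u := 1))) ''i'')
      (0 := (s(''cur'' := (s ''cur'')(?u := r), ''sel'' := (s ''sel'')(?u := 1))) ''n'' 0 - 1)) = ?s"
    using n by simp
  show ?thesis unfolding trace_phase_def runs_Seq runs_Write aval.simps st st2
    by (rule runs_mono[OF run]) (use n q in auto)
qed

end

lemma (in safe_set_instance) runs_solve:
  assumes S: "connected_safe_set T wm wp S" "sum wm S \<le> W"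
  shows "runs solve start (\<lambda>t s. t \<le> n * 400 + 500 +
    (W + 1) * (n * ((W + 1) * (W + 1) * 60 + (W + 1) * 140 + 300) + 200) \<and>
    min_connected_safe_set T wm wp (output_set n s))"
proof -
  let ?B = "(W + 1) * (n * ((W + 1) * (W + 1) * 60 + (W + 1) * 140 + 300) + 200) + 20"
  have tail: "runs (prepare_phase ;; search_loop ;; trace_phase ;; (assign ''i'' (Const 0) ;; output_loop)) s
      (\<lambda>t s'. t \<le> n * 120 + 160 + (?B + (n * 80 + 50 + (n * 40 + 30))) \<and>
        min_connected_safe_set T wm wp (output_set n s'))"
    if s: "peeled n (parcs T) (s ''q'') (s ''t'' 0) (s ''deg'') (s ''ns'') (n - 1) \<and>
     (\<forall>x. x \<notin> order_arrays \<longrightarrow> s x = start x)" for s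
  proof -
    \<comment> \<open>The rooted tree is read off from the queue, so it can be instantiated only for
      the state that the first phase has reached.\<close>
    interpret ordered_instance n T es wm wp W "s ''q''" "s ''ns''" "s ''t'' 0" "s ''deg''"
      using s by unfold_locales auto
    let ?q = "s ''q''"
    define r where "r = (LEAST r. \<exists>u. feasible a b r u)"
    have ex: "\<exists>u. feasible a b (sum wm S) u" by (rule connected_safe_set_feasible[OF S(1)])
    then have "\<exists>u. feasible a b r u" unfolding r_def by (rule LeastI)
    then obtain v where v: "feasible a b r v" by blast
    have "r \<le> sum wm S" unfolding r_def using ex by (rule Least_le)
    then have r: "r \<le> W" using S(2) by simp
    have least: "\<not> feasible a b k u" if "k < r" for k u
      using not_less_Least[OF that[unfolded r_def]] by blast
    have out: "runs (assign ''i'' (Const 0) ;; output_loop) s1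
        (\<lambda>t s'. t \<le> n * 40 + 30 \<and> min_connected_safe_set T wm wp (output_set n s'))"
      if h: "s1 ''n'' 0 = n \<and> s1 ''q'' = ?q \<and> (\<exists>u. top_safe b r u {x. s1 ''sel'' x \<noteq> 0}) \<and>
        sum a {x. s1 ''sel'' x \<noteq> 0} = r" for s1
    proof -
      let ?s = "s1(''i'' := (s1 ''i'')(0 := 0))"
      obtain u where u: "top_safe b r u {x. s1 ''sel'' x \<noteq> 0}" using h by blast
      then have sub: "{x. s1 ''sel'' x \<noteq> 0} \<subseteq> {..<n}" by (auto simp: top_safe_def)
      have min: "min_connected_safe_set T wm wp (?q ` {x. s1 ''sel'' x \<noteq> 0})"
        using h by (intro min_connected_safe_setI[OF u _ least]) auto
      have "{i. i < n \<and> ?s ''sel'' i \<noteq> 0} = {x. s1 ''sel'' x \<noteq> 0}" using sub by auto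
      moreover have "runs output_loop ?s (\<lambda>t s'. t \<le> n * 40 + 20 \<and>
          output_set n s' = ?s ''q'' ` {i. i < n \<and> ?s ''sel'' i \<noteq> 0})"
        using h bij by (intro runs_output_loop) simp_all
      ultimately have run: "runs output_loop ?s (\<lambda>t s'. t \<le> n * 40 + 20 \<and>
          output_set n s' = ?q ` {x. s1 ''sel'' x \<noteq> 0})" using h by simp
      show ?thesis unfolding runs_Seq runs_Write aval.simps
        by (rule runs_mono[OF run]) (use min in auto)
    qed
    have prep: "runs prepare_phase s (\<lambda>t s'. t \<le> n * 120 + 160 \<and>
        (prepared s' \<and> s' ''k'' 0 = 0 \<and> s' ''f'' 0 = 0))"
      using s by (intro runs_prepare_phase) auto
    show ?thesis
      by (rule runs_SeqI[OF prep runs_SeqI[OF runs_search[OF _ r v least]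
            runs_SeqI[OF runs_trace_phase[OF _ r] out order_refl] order_refl] order_refl])
  qed
  show ?thesis unfolding solve_def
    by (rule runs_SeqI[OF runs_order_phase tail]) simp_all
qed

text \<open>The estimate is cubic in \<open>W\<close> until the last step,
  \<open>W ^ 3 \<le> W ^ 4\<close>. Positivity of \<open>n\<close> and \<open>W\<close> absorbs the
  additive constants, and \<open>W + 1 \<le> 2 * W\<close> bounds the inner factor by 820 = 240 +
  280 + 300 times \<open>W * W\<close>. Any constant from 400 + 500 + 2040 upwards would do; 5000 is
  a round one.\<close>

lemma time_bound:
  fixes n W :: nat
  assumes "0 < n" "1 \<le> W"
  shows "n * 400 + 500 + (W + 1) * (n * ((W + 1) * (W + 1) * 60 + (W + 1) * 140 + 300) + 200)
    \<le> 5000 * (n * W ^ 4)"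
proof -
  have W2: "W \<le> W * W" "1 \<le> W * W" using assms by auto
  have V: "W + 1 \<le> 2 * W" using assms by simp
  have "X * 60 + (W + 1) * 140 + 300 \<le> 820 * Y" if "X \<le> 4 * Y" "W \<le> Y" "1 \<le> Y" for X Y :: nat
  proof -
    have "X * 60 \<le> 240 * Y" "(W + 1) * 140 \<le> 280 * Y" "300 \<le> 300 * Y" using that by simp_all
    then have "X * 60 + (W + 1) * 140 + 300 \<le> 240 * Y + 280 * Y + 300 * Y" by (intro add_mono)
    then show ?thesis by simp
  qed
  moreover have "(W + 1) * (W + 1) \<le> 4 * (W * W)" using mult_le_mono[OF V V] by simp
  ultimately have "(W + 1) * (W + 1) * 60 + (W + 1) * 140 + 300 \<le> 820 * (W * W)" using W2 by blast
  then have "n * ((W + 1) * (W + 1) * 60 + (W + 1) * 140 + 300) \<le> n * (820 * (W * W))" by (rule mult_le_mono2)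
  moreover have nW: "1 \<le> n * (W * W)" using assms by simp
  ultimately have "n * ((W + 1) * (W + 1) * 60 + (W + 1) * 140 + 300) + 200 \<le> 1020 * (n * (W * W))" by linarith
  with V have "(W + 1) * (n * ((W + 1) * (W + 1) * 60 + (W + 1) * 140 + 300) + 200)
      \<le> (2 * W) * (1020 * (n * (W * W)))" by (rule mult_le_mono)
  also have "\<dots> = 2040 * (n * W ^ 3)" by (simp add: power3_eq_cube)
  also have "\<dots> \<le> 2040 * (n * W ^ 4)" using assms by (intro mult_le_mono power_increasing) auto
  finally have "(W + 1) * (n * ((W + 1) * (W + 1) * 60 + (W + 1) * 140 + 300) + 200) \<le> 2040 * (n * W ^ 4)" .
  moreover have "n * 1 \<le> n * W ^ 4" using assms by (intro mult_le_mono2) simp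
  moreover have "1 \<le> n" using assms by simp
  ultimately show ?thesis by linarith
qed

theorem theorem2:
  shows "\<exists>(P :: com) (c :: nat).
    \<forall>(n :: nat) (T :: nat pair_pre_digraph) es (wm :: nat \<Rightarrow> nat) (wp :: nat \<Rightarrow> nat) (W :: nat).
      undirected_tree T \<and> pverts T = {..<n} \<and> is_edge_list T es \<and> 1 \<le> W \<and>
      (\<exists>S. connected_safe_set T wm wp S \<and> (\<Sum>v \<in> S. wm v) \<le> W) \<longrightarrow>
      (\<exists>t s. exec P (input_state n es wm wp W) t s \<and>
             t \<le> c * (n * W ^ 4) \<and>
             min_connected_safe_set T wm wp (output_set n s))"
proof (rule exI[of _ solve], rule exI[of _ 5000], intro allI impI, elim conjE exE)
  fix n :: nat and T :: "nat pair_pre_digraph" and es and wm wp :: "nat \<Rightarrow> nat" and W :: nat and S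
  assume "undirected_tree T" "pverts T = {..<n}" "is_edge_list T es" and W: "1 \<le> W"
    and S: "connected_safe_set T wm wp S" "sum wm S \<le> W"
  then interpret safe_set_instance n T es wm wp W by unfold_locales
  show "\<exists>t s. exec solve (input_state n es wm wp W) t s \<and> t \<le> 5000 * (n * W ^ 4) \<and>
      min_connected_safe_set T wm wp (output_set n s)"
    using runs_solve[OF S] time_bound[OF n_pos W] unfolding runs_def by (meson order_trans)
qed

end
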